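(* Let $T$ be an endomorphism of $(X,\mathcal{A},\mu)$. The following assertions are equivalent: (1) $(X,\mathcal{A},\mu,T)$ is of zero type; (2) $\{T^{n}\}_{n\in\mathbb{N}}$ tends weakly to $0$ in $L^{\Phi}(\mu)$, i.e. for every $f\in L^{\Phi}(\mu)$, $f\circ T^{n}\to0$ in the weak topology of $L^{\Phi}(\mu)$; (3) for every strictly increasing sequence $\{n_{k}\}_{k\in\mathbb{N}}$ of integers and every $f\in L^{1}(\mu)$ (or, equivalently, every $f\in L^{\Phi}(\mu)$), $$\left\|\frac{1}{n}\sum_{k=1}^{n}f\circ T^{n_{k}}\right\|_{*}\to0\quad\text{as } n\to\infty.$$
   Context: $(X,\mathcal{A},\mu)$ is a non-atomic infinite Borel measure space, i.e. measurably isomorphic to the real line with its Borel sets and Lebesgue measure; $\mathcal{A}_f$ is the collection of sets in $\mathcal{A}$ of finite $\mu$-measure. An endomorphism $T$ is a measurable map $T:X\to X$ with $\mu(T^{-1}A)=\mu(A)$ for all $A\in\mathcal{A}$. $T$ also denotes the operator $f\mapsto f\circ T$. The system is of zero type if $\mu(A\cap T^{-n}B)\to0$ as $n\to\infty$ for all $A,B\in\mathcal{A}_f$. Poisson space $(X^{*},\mathcal{A}^{*},\mu^{*})$: $X^{*}$ is the set of measures of the form $\sum_{i\in I}\delta_{x_i}$, $x_i\in X$, $I$ countable; $\mathcal{A}^{*}=\sigma\{N(A): A\in\mathcal{A}\}$ with $N(A)(\omega)=\omega(A)$; $\mu^{*}$ is the unique probability measure such that for pairwise disjoint $A_1,\dots,A_k\in\mathcal{A}_f$,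 $N(A_1),\dots,N(A_k)$ are independent and Poisson distributed with parameters $\mu(A_1),\dots,\mu(A_k)$. For $f\in L^1(\mu)$, $N(f)(\omega)=\int_X f\,d\omega$ and $\mu(f)=\int_X f\,d\mu$. Let $\Phi(x)=x^{2}$ for $0\le x\le1$ and $\Phi(x)=2x-1$ for $x>1$; $L^{\Phi}(\mu)=\{f\in L^{0}(\mu):\int_X\Phi(|f|)\,d\mu<\infty\}$, which contains $L^1(\mu)$. For $f\in L^{\Phi}(\mu)$, $I_1(f):=\lim_{\epsilon\to0}\big(N(f1_{|f|>\epsilon})-\mu(f1_{|f|>\epsilon})\big)$ (limit in $\mu^{*}$-measure), an integrable centered random variable, and the Poisson-Orlicz norm is $\|f\|_{*}:=\|I_1(f)\|_{L^{1}(\mu^{*})}$. This norm makes $L^{\Phi}(\mu)$ a Banach space (it is equivalent to the usual Orlicz norms on $L^\Phi(\mu)$), whose topological dual is identified with $L^{2}(\mu)\cap L^{\infty}(\mu)$ through the pairing $(f,g)\mapsto\int_X fg\,d\mu$. *)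

theory Defs
  imports "HOL-Probability.Probability"
begin

section \<open>The base system\<close>

definition isomorphic_to_real_line :: "'a measure \<Rightarrow> bool" where
  "isomorphic_to_real_line M \<longleftrightarrow>
     (\<exists>\<phi> :: 'a \<Rightarrow> real. bij_betw \<phi> (space M) UNIV
        \<and> \<phi> \<in> measurable M borel
        \<and> inv_into (space M) \<phi> \<in> measurable borel M
        \<and> distr M borel \<phi> = lborel)"

definition endomorphism :: "'a measure \<Rightarrow> ('a \<Rightarrow> 'a) \<Rightarrow> bool" where
  "endomorphism M T \<longleftrightarrow>
     T \<in> measurable M M \<and> (\<forall>A\<in>sets M. emeasure M (T -` A \<inter> space M) = emeasure M A)"

definition finite_sets :: "'a measure \<Rightarrow> 'a set set" where
  "finite_sets M = {A \<in> sets M. emeasure M A < \<infinity>}"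

definition zero_type :: "'a measure \<Rightarrow> ('a \<Rightarrow> 'a) \<Rightarrow> bool" where
  "zero_type M T \<longleftrightarrow>
     (\<forall>A\<in>finite_sets M. \<forall>B\<in>finite_sets M.
        (\<lambda>n. measure M (A \<inter> ((T ^^ n) -` B \<inter> space M))) \<longlonglongrightarrow> 0)"


section \<open>The Poisson space\<close>

text \<open>
  The measure \<open>\<Sum>i\<in>I. \<delta> (x i)\<close> is the image of counting measure on \<open>I\<close> under \<open>x\<close>.
  Repeated points are allowed, and every countable index set may be taken inside \<^typ>\<open>nat\<close>.
\<close>

definition configurations :: "'a measure \<Rightarrow> 'a measure set" where
  "configurations M =
     {distr (count_space I) M x | (I :: nat set) x. x \<in> I \<rightarrow> space M}"

lemma emeasure_configuration:
  assumes "x \<in> I \<rightarrow> space M" and "A \<in> sets M"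
  shows "emeasure (distr (count_space I) M x) A =
    (\<integral>\<^sup>+ i. emeasure (return M (x i)) A \<partial>count_space I)"
proof -
  have "emeasure (distr (count_space I) M x) A = emeasure (count_space I) (x -` A \<inter> I)"
    using assms by (subst emeasure_distr) auto
  also have "\<dots> = (\<integral>\<^sup>+ i. indicator (x -` A \<inter> I) i \<partial>count_space I)"
    by (rule nn_integral_indicator [symmetric]) auto
  also have "\<dots> = (\<integral>\<^sup>+ i. emeasure (return M (x i)) A \<partial>count_space I)"
    using assms by (intro nn_integral_cong) (auto simp: indicator_def)
  finally show ?thesis .
qed

definition configuration_algebra :: "'a measure \<Rightarrow> 'a measure measure" where
  "configuration_algebra M =
     sigma (configurations M)
       {{\<omega> \<in> configurations M. emeasure \<omega> A \<in> B} | A B. A \<in> sets M \<and> B \<in> sets borel}"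

text \<open>
  The Poisson distribution is written out because \<^const>\<open>poisson_pmf\<close> is only specified for
  positive rates, whereas null sets (rate \<open>0\<close>, with \<open>0 ^ 0 = 1\<close>) are included here.
\<close>

definition is_poisson_measure :: "'a measure \<Rightarrow> 'a measure measure \<Rightarrow> bool" where
  "is_poisson_measure M P \<longleftrightarrow>
     prob_space P \<and> sets P = sets (configuration_algebra M) \<and>
     (\<forall>(k :: nat) A. A ` {1..k} \<subseteq> finite_sets M \<and> disjoint_family_on A {1..k} \<longrightarrow>
        prob_space.indep_vars P (\<lambda>_. borel) (\<lambda>i \<omega>. emeasure \<omega> (A i)) {1..k} \<and>
        (\<forall>i\<in>{1..k}. \<forall>n :: nat.
           measure P {\<omega> \<in> space P. emeasure \<omega> (A i) = of_nat n} =
             measure M (A i) ^ n / fact n * exp (- measure M (A i))))"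


section \<open>The Poisson-Orlicz space\<close>

definition Phi :: "real \<Rightarrow> real" where
  "Phi x = (if x \<le> 1 then x\<^sup>2 else 2 * x - 1)"

text \<open>
  As with the integrals of the library, elements of the function spaces are represented by
  functions rather than by their classes modulo equality almost everywhere.
\<close>

definition L_Phi :: "'a measure \<Rightarrow> ('a \<Rightarrow> real) set" where
  "L_Phi M = {f \<in> borel_measurable M. (\<integral>\<^sup>+ x. ennreal (Phi \<bar>f x\<bar>) \<partial>M) < \<infinity>}"

definition tendsto_in_measure ::
    "'b measure \<Rightarrow> ('i \<Rightarrow> 'b \<Rightarrow> real) \<Rightarrow> ('b \<Rightarrow> real) \<Rightarrow> 'i filter \<Rightarrow> bool" where
  "tendsto_in_measure P Z Y F \<longleftrightarrow>
     (\<forall>\<delta>>0. ((\<lambda>i. measure P {\<omega> \<in> space P. \<bar>Z i \<omega> - Y \<omega>\<bar> > \<delta>}) \<longlongrightarrow> 0) F)"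

definition random_sum :: "('a \<Rightarrow> real) \<Rightarrow> 'a measure \<Rightarrow> real" where
  "random_sum f \<omega> = (\<integral>x. f x \<partial>\<omega>)"

definition truncation :: "('a \<Rightarrow> real) \<Rightarrow> real \<Rightarrow> 'a \<Rightarrow> real" where
  "truncation f \<epsilon> x = f x * indicator {y. \<bar>f y\<bar> > \<epsilon>} x"

text \<open>A limit in measure is only determined almost everywhere, so a version has to be chosen.\<close>

definition I\<^sub>1 :: "'a measure \<Rightarrow> 'a measure measure \<Rightarrow> ('a \<Rightarrow> real) \<Rightarrow> 'a measure \<Rightarrow> real" where
  "I\<^sub>1 M P f =
     (SOME Y. Y \<in> borel_measurable P \<and>
        tendsto_in_measure P
          (\<lambda>\<epsilon> \<omega>. random_sum (truncation f \<epsilon>) \<omega> - (\<integral>x. truncation f \<epsilon> x \<partial>M)) Y (at_right 0))"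

definition poisson_orlicz_norm ::
    "'a measure \<Rightarrow> 'a measure measure \<Rightarrow> ('a \<Rightarrow> real) \<Rightarrow> real" where
  "poisson_orlicz_norm M P f = (\<integral>\<omega>. \<bar>I\<^sub>1 M P f \<omega>\<bar> \<partial>P)"

text \<open>
  The bound forces a functional to agree on functions that are equal almost everywhere, so
  these are exactly the continuous linear functionals on the space of classes.
\<close>

definition continuous_functional ::
    "'a measure \<Rightarrow> 'a measure measure \<Rightarrow> (('a \<Rightarrow> real) \<Rightarrow> real) \<Rightarrow> bool" where
  "continuous_functional M P l \<longleftrightarrow>
     (\<forall>f\<in>L_Phi M. \<forall>g\<in>L_Phi M. l (\<lambda>x. f x + g x) = l f + l g) \<and>
     (\<forall>f\<in>L_Phi M. \<forall>c. l (\<lambda>x. c * f x) = c * l f) \<and>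
     (\<exists>C. \<forall>f\<in>L_Phi M. \<bar>l f\<bar> \<le> C * poisson_orlicz_norm M P f)"

definition tendsto_weakly ::
    "'a measure \<Rightarrow> 'a measure measure \<Rightarrow> (nat \<Rightarrow> 'a \<Rightarrow> real) \<Rightarrow> ('a \<Rightarrow> real) \<Rightarrow> bool" where
  "tendsto_weakly M P u f \<longleftrightarrow>
     (\<forall>l. continuous_functional M P l \<longrightarrow> (\<lambda>n. l (u n)) \<longlonglongrightarrow> l f)"

text \<open>
  The sequence is indexed from \<open>1\<close> on, hence monotonicity is only imposed there; in
  particular \<open>s 1 = 0\<close> is allowed.
\<close>

definition subsequence_averages_vanish ::
    "'a measure \<Rightarrow> 'a measure measure \<Rightarrow> ('a \<Rightarrow> 'a) \<Rightarrow> ('a \<Rightarrow> real) set \<Rightarrow> bool" where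
  "subsequence_averages_vanish M P T F \<longleftrightarrow>
     (\<forall>s :: nat \<Rightarrow> nat. strict_mono_on {1..} s \<longrightarrow> (\<forall>f\<in>F.
        (\<lambda>n. poisson_orlicz_norm M P
               (\<lambda>x. 1 / real n * (\<Sum>k=1..n. f ((T ^^ s k) x)))) \<longlonglongrightarrow> 0))"

end

theory Submission
  imports Defs
begin

text \<open>
  Second moments of the counts give \<open>\<parallel>p + q\<parallel>\<^sub>* \<le> 2 \<parallel>p\<parallel>\<^sub>1 + \<parallel>q\<parallel>\<^sub>2\<close>, and both norms on the right
  are \<open>T\<close>-invariant. Up to a small error of this kind, \<open>f\<close> is bounded and carried by a set \<open>A\<close>
  of finite measure. For zero type \<open>T\<close> the \<open>L\<^sup>2\<close> norm of the averages of such a function tends to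
  \<open>0\<close>, because strictly increasing indices make \<open>\<mu>(T\<^sup>-\<^sup>i A \<inter> T\<^sup>-\<^sup>j A)\<close> small away from the diagonal.

  Conversely, testing \<open>I\<^sub>1(f)\<close> against the indicator of the event \<open>N(A) = 0\<close> gives
  \<open>- exp(- \<mu>(A)) \<integral>\<^sub>A f d\<mu>\<close>, so integration over \<open>A\<close> is a continuous functional and a
  failure of zero type is visible both weakly and in the norm of averages. Weak convergence follows from
  convergence of averages along all subsequences, applied to a subsequence on which a functional stays
  away from \<open>0\<close> with a constant sign.
\<close>

section \<open>Poisson measures and Campbell's formula\<close>

text \<open>\<open>Phi\<close> is quadratic near 0 and linear at infinity, so \<open>L_Phi\<close>
  is the sum of \<open>L^1\<close> and \<open>L^2\<close>: large values of a function are summable,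
  small values are square summable. This is why an \<open>L^1\<close> and an \<open>L^2\<close>
  estimate stand side by side, and why cutting \<open>f\<close> by size leaves a bounded middle
  piece on a set of finite measure. The factor 2 pays once for the random sum and once for its
  compensator.

  The obstacle is \<open>I\<^sub>1\<close>, a version of a limit in measure picked by choice. Both
  the upper and the lower bound on the norm are therefore proved for truncations, where the centred
  sum of an integrable function is a concrete random variable, and carried over by
  \<open>poisson_orlicz_norm_limit\<close>.

  The void event of \<open>A\<close> is a good test variable because it is bounded and acts simply
  on the points: it removes those in \<open>A\<close> and, by independence, leaves the law outside
  \<open>A\<close> unchanged, at the price of the factor exp(-mu(A)). The compensator still
  integrates over all of the space; the discrepancy is the integral over \<open>A\<close>.\<close>

lemma exp_series_sums:
  fixes x :: real
  shows "(\<lambda>n. x ^ n / fact n) sums exp x"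
  using exp_converges [of x] by (simp add: scaleR_conv_of_real divide_inverse mult.commute)

lemma poisson_mass_sums:
  fixes x :: real
  shows "(\<lambda>n. x ^ n / fact n * exp (- x)) sums 1"
  using sums_mult2 [OF exp_series_sums [of x], of "exp (- x)"] by (simp add: exp_minus)

text \<open>The term at 0 vanishes, and shifting the index by one cancels the factor n against the
  factorial: what remains is x times the total mass.\<close>

lemma poisson_mean_sums:
  fixes x :: real
  shows "(\<lambda>n. real n * (x ^ n / fact n * exp (- x))) sums x"
proof -
  have "(\<lambda>n. real (Suc n) * (x ^ Suc n / fact (Suc n) * exp (- x))) sums x"
    using sums_mult [OF poisson_mass_sums, of x x]
    by (simp add: field_simps del: of_nat_Suc)
  then show ?thesis
    using sums_Suc [of "\<lambda>n. real n * (x ^ n / fact n * exp (- x))" x] by simp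
qed

text \<open>After the index shift one factor n + 1 cancels against the factorial. The other one
  splits the series into x times (mean + mass), that is x * (x + 1).\<close>

lemma poisson_second_moment_sums:
  fixes x :: real
  shows "(\<lambda>n. (real n)\<^sup>2 * (x ^ n / fact n * exp (- x))) sums (x\<^sup>2 + x)"
proof -
  have "(real (Suc n))\<^sup>2 * (x ^ Suc n / fact (Suc n) * exp (- x))
      = x * (real n * (x ^ n / fact n * exp (- x)) + x ^ n / fact n * exp (- x))" for n
  proof -
    have "(real (Suc n))\<^sup>2 / fact (Suc n) = (real n + 1) / fact n"
      by (simp add: power2_eq_square del: of_nat_Suc)
    then have "(real (Suc n))\<^sup>2 * (x ^ Suc n / fact (Suc n) * exp (- x))
        = (real n + 1) / fact n * (x ^ Suc n * exp (- x))"
      by (metis (no_types, lifting) times_divide_eq_left times_divide_eq_right)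
    then show ?thesis
      by (simp add: algebra_simps add_divide_distrib)
  qed
  then have "(\<lambda>n. (real (Suc n))\<^sup>2 * (x ^ Suc n / fact (Suc n) * exp (- x))) sums (x * (x + 1))"
    using sums_mult [OF sums_add [OF poisson_mean_sums poisson_mass_sums], of x x] by presburger
  then show ?thesis
    using sums_Suc [of "\<lambda>n. (real n)\<^sup>2 * (x ^ n / fact n * exp (- x))" "x * (x + 1)"]
    by (simp add: power2_eq_square algebra_simps)
qed

text \<open>Sigma-finiteness is what the isomorphism with the real line contributes: it lets
  identities known for sets of finite measure reach all measurable sets.\<close>

locale poisson_space =
  fixes M :: "'a measure" and P :: "'a measure measure"
  assumes sigma_finite: "sigma_finite_measure M"
    and poisson: "is_poisson_measure M P"

sublocale poisson_space \<subseteq> base: sigma_finite_measure M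
  by (rule sigma_finite)

sublocale poisson_space \<subseteq> prob_space P
  using poisson by (simp add: is_poisson_measure_def)

context poisson_space
begin

section \<open>Measurability on the space of configurations\<close>

lemma sets_P: "sets P = sets (configuration_algebra M)"
  using poisson by (simp add: is_poisson_measure_def)

lemma configuration_algebra_subset:
  "{{\<omega> \<in> configurations M. emeasure \<omega> A \<in> B} | A B. A \<in> sets M \<and> B \<in> sets borel}
    \<subseteq> Pow (configurations M)"
  by auto

lemma space_P: "space P = configurations M"
  using sets_eq_imp_space_eq [OF sets_P]
  by (simp add: configuration_algebra_def space_measure_of [OF configuration_algebra_subset])

lemma sets_config [measurable_cong]: "\<omega> \<in> space P \<Longrightarrow> sets \<omega> = sets M"
  by (auto simp: space_P configurations_def)

lemma measurable_config_iff: "\<omega> \<in> space P \<Longrightarrow> measurable \<omega> N = measurable M N"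
  by (rule measurable_cong_sets) (simp_all add: sets_config)

lemma measurable_count [measurable (raw)]:
  assumes "A \<in> sets M"
  shows "(\<lambda>\<omega>. emeasure \<omega> A) \<in> borel_measurable P"
proof (rule measurableI)
  fix B :: "ennreal set" assume "B \<in> sets borel"
  then have "{\<omega> \<in> configurations M. emeasure \<omega> A \<in> B} \<in> sets (configuration_algebra M)"
    unfolding configuration_algebra_def sets_measure_of [OF configuration_algebra_subset]
    using assms by (intro sigma_sets.Basic) auto
  then show "(\<lambda>\<omega>. emeasure \<omega> A) -` B \<inter> space P \<in> sets P"
    by (simp add: sets_P space_P vimage_def Int_def conj_commute)
qed simp

text \<open>Counts are measurable by the choice of the sigma-algebra, and induction over nonnegative
  measurable functions does the rest. The identities between integrals are claimed on
  \<open>space P\<close> only, where \<open>sets \<omega>\<close> is known to be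
  \<open>sets M\<close>.\<close>

lemma measurable_nn_integral_config [measurable (raw)]:
  assumes "f \<in> borel_measurable M"
  shows "(\<lambda>\<omega>. \<integral>\<^sup>+x. f x \<partial>\<omega>) \<in> borel_measurable P"
  using assms
proof (induction rule: borel_measurable_induct)
  case (cong f g)
  have "(\<integral>\<^sup>+x. f x \<partial>\<omega>) = (\<integral>\<^sup>+x. g x \<partial>\<omega>)" if "\<omega> \<in> space P" for \<omega>
    using cong sets_eq_imp_space_eq [OF sets_config [OF that]] by (intro nn_integral_cong) auto
  then show ?case
    using cong by (simp cong: measurable_cong)
next
  case (set A)
  then have "(\<integral>\<^sup>+x. indicator A x \<partial>\<omega>) = emeasure \<omega> A" if "\<omega> \<in> space P" for \<omega>
    using that by (simp add: sets_config)
  then show ?case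
    using measurable_count [OF set] by (simp cong: measurable_cong)
next
  case (mult u c)
  then have "(\<integral>\<^sup>+x. c * u x \<partial>\<omega>) = c * (\<integral>\<^sup>+x. u x \<partial>\<omega>)" if "\<omega> \<in> space P" for \<omega>
    using that by (intro nn_integral_cmult) (simp add: measurable_config_iff)
  then show ?case
    using mult by (simp cong: measurable_cong)
next
  case (add u v)
  then have "(\<integral>\<^sup>+x. v x + u x \<partial>\<omega>) = (\<integral>\<^sup>+x. v x \<partial>\<omega>) + (\<integral>\<^sup>+x. u x \<partial>\<omega>)" if "\<omega> \<in> space P" for \<omega>
    using that by (intro nn_integral_add) (simp_all add: measurable_config_iff)
  then show ?case
    using add by (simp cong: measurable_cong)
next
  case (seq U)
  then have "(\<integral>\<^sup>+x. (SUP i. U i) x \<partial>\<omega>) = (SUP i. \<integral>\<^sup>+x. U i x \<partial>\<omega>)" if "\<omega> \<in> space P" for \<omega>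
    using that unfolding SUP_apply
    by (intro nn_integral_monotone_convergence_SUP) (simp_all add: measurable_config_iff)
  then show ?case
    using seq by (simp cong: measurable_cong)
qed

text \<open>A random weight \<open>W\<close> changes the intensity measure by a density
  \<open>w\<close>; it is enough to know this on sets of finite measure. The instances use for
  \<open>W\<close> the constant 1, the indicator of a void event, the count of a set, and the
  integral of a second function.\<close>

lemma weighted_campbell:
  assumes W [measurable]: "W \<in> borel_measurable P" and w [measurable]: "w \<in> borel_measurable M"
    and eq: "\<And>A. A \<in> finite_sets M \<Longrightarrow>
      (\<integral>\<^sup>+\<omega>. emeasure \<omega> A * W \<omega> \<partial>P) = (\<integral>\<^sup>+x. indicator A x * w x \<partial>M)"
    and "f \<in> borel_measurable M"
  shows "(\<integral>\<^sup>+\<omega>. (\<integral>\<^sup>+x. f x \<partial>\<omega>) * W \<omega> \<partial>P) = (\<integral>\<^sup>+x. f x * w x \<partial>M)"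
  using \<open>f \<in> borel_measurable M\<close>
proof (induction rule: borel_measurable_induct)
  case (cong f g)
  have "(\<integral>\<^sup>+x. f x \<partial>\<omega>) = (\<integral>\<^sup>+x. g x \<partial>\<omega>)" if "\<omega> \<in> space P" for \<omega>
    using cong sets_eq_imp_space_eq [OF sets_config [OF that]] by (intro nn_integral_cong) auto
  then have "(\<integral>\<^sup>+\<omega>. (\<integral>\<^sup>+x. f x \<partial>\<omega>) * W \<omega> \<partial>P) = (\<integral>\<^sup>+\<omega>. (\<integral>\<^sup>+x. g x \<partial>\<omega>) * W \<omega> \<partial>P)"
    by (intro nn_integral_cong) simp
  moreover have "(\<integral>\<^sup>+x. f x * w x \<partial>M) = (\<integral>\<^sup>+x. g x * w x \<partial>M)"
    using cong by (intro nn_integral_cong) simp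
  ultimately show ?case
    using cong by simp
next
  case (set A)
  obtain K :: "nat \<Rightarrow> 'a set" where K: "range K \<subseteq> sets M" "(\<Union>i. K i) = space M"
    "\<And>i. emeasure M (K i) \<noteq> \<infinity>" "incseq K"
    using base.sigma_finite_incseq by metis
  \<comment> \<open>The hypothesis \<open>eq\<close> speaks of finite measure only, so
    \<open>A\<close> is exhausted by its traces on the increasing cover \<open>K\<close>.\<close>
  define D where "D i = A \<inter> K i" for i
  have D [measurable]: "D i \<in> sets M" for i
    using K set by (auto simp: D_def)
  have "emeasure M (D i) \<le> emeasure M (K i)" for i
    using K by (intro emeasure_mono) (auto simp: D_def)
  then have fin: "D i \<in> finite_sets M" for i
    using K(3) [of i] D by (auto simp: finite_sets_def top.not_eq_extremum intro: le_less_trans)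
  have inc: "incseq D"
    using K(4) by (auto simp: D_def incseq_def)
  have UN: "(\<Union>i. D i) = A"
    using K(2) sets.sets_into_space [OF set] by (auto simp: D_def)
  have count: "emeasure \<omega> A = (SUP i. emeasure \<omega> (D i))" if "\<omega> \<in> space P" for \<omega>
    using SUP_emeasure_incseq [of D \<omega>] inc D that by (simp add: UN sets_config image_subset_iff)
  have "(\<integral>\<^sup>+\<omega>. (\<integral>\<^sup>+x. indicator A x \<partial>\<omega>) * W \<omega> \<partial>P)
      = (\<integral>\<^sup>+\<omega>. (SUP i. emeasure \<omega> (D i) * W \<omega>) \<partial>P)"
    using set by (intro nn_integral_cong) (simp add: sets_config count SUP_mult_right_ennreal)
  also have "\<dots> = (SUP i. \<integral>\<^sup>+\<omega>. emeasure \<omega> (D i) * W \<omega> \<partial>P)"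
  proof (rule nn_integral_monotone_convergence_SUP_AE)
    show "AE \<omega> in P. emeasure \<omega> (D i) * W \<omega> \<le> emeasure \<omega> (D (Suc i)) * W \<omega>" for i
      using inc D by (intro AE_I2 mult_right_mono emeasure_mono) (auto simp: incseq_SucD sets_config)
  qed simp
  also have "\<dots> = (SUP i. \<integral>\<^sup>+x. indicator (D i) x * w x \<partial>M)"
    by (simp add: eq fin)
  also have "\<dots> = (\<integral>\<^sup>+x. (SUP i. indicator (D i) x * w x) \<partial>M)"
  proof (rule nn_integral_monotone_convergence_SUP_AE [symmetric])
    show "AE x in M. indicator (D i) x * w x \<le> indicator (D (Suc i)) x * w x" for i
      using incseq_SucD [OF inc, of i] by (intro AE_I2 mult_right_mono) (auto simp: indicator_def)
  qed simp
  also have "\<dots> = (\<integral>\<^sup>+x. indicator A x * w x \<partial>M)"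
  proof (rule nn_integral_cong)
    fix x
    have "(SUP i. indicator (D i) x :: ennreal) = indicator A x"
      using LIMSEQ_indicator_incseq [OF inc, of x] inc
      by (intro LIMSEQ_unique [OF LIMSEQ_SUP])
         (auto simp: UN incseq_def indicator_def)
    then show "(SUP i. indicator (D i) x * w x) = indicator A x * w x"
      by (simp add: SUP_mult_right_ennreal [symmetric])
  qed
  finally show ?case .
next
  case (mult u c)
  then have "(\<integral>\<^sup>+x. c * u x \<partial>\<omega>) = c * (\<integral>\<^sup>+x. u x \<partial>\<omega>)" if "\<omega> \<in> space P" for \<omega>
    using that by (intro nn_integral_cmult) (simp add: measurable_config_iff)
  then have "(\<integral>\<^sup>+\<omega>. (\<integral>\<^sup>+x. c * u x \<partial>\<omega>) * W \<omega> \<partial>P) = (\<integral>\<^sup>+\<omega>. c * ((\<integral>\<^sup>+x. u x \<partial>\<omega>) * W \<omega>) \<partial>P)"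
    by (intro nn_integral_cong) (simp add: mult.assoc)
  then show ?case
    using mult by (simp add: nn_integral_cmult mult.assoc)
next
  case (add u v)
  then have "(\<integral>\<^sup>+x. v x + u x \<partial>\<omega>) = (\<integral>\<^sup>+x. v x \<partial>\<omega>) + (\<integral>\<^sup>+x. u x \<partial>\<omega>)" if "\<omega> \<in> space P" for \<omega>
    using that by (intro nn_integral_add) (simp_all add: measurable_config_iff)
  then have "(\<integral>\<^sup>+\<omega>. (\<integral>\<^sup>+x. v x + u x \<partial>\<omega>) * W \<omega> \<partial>P)
      = (\<integral>\<^sup>+\<omega>. (\<integral>\<^sup>+x. v x \<partial>\<omega>) * W \<omega> + (\<integral>\<^sup>+x. u x \<partial>\<omega>) * W \<omega> \<partial>P)"
    by (intro nn_integral_cong) (simp add: distrib_right)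
  then show ?case
    using add by (simp add: nn_integral_add distrib_right)
next
  case (seq U)
  have le: "U i x \<le> U (Suc i) x" for i x
    using \<open>incseq U\<close> by (simp add: incseq_SucD le_funD)
  have "(\<integral>\<^sup>+x. (SUP i. U i) x \<partial>\<omega>) = (SUP i. \<integral>\<^sup>+x. U i x \<partial>\<omega>)" if "\<omega> \<in> space P" for \<omega>
    using that seq unfolding SUP_apply
    by (intro nn_integral_monotone_convergence_SUP) (simp_all add: measurable_config_iff)
  then have "(\<integral>\<^sup>+\<omega>. (\<integral>\<^sup>+x. (SUP i. U i) x \<partial>\<omega>) * W \<omega> \<partial>P)
      = (\<integral>\<^sup>+\<omega>. (SUP i. (\<integral>\<^sup>+x. U i x \<partial>\<omega>) * W \<omega>) \<partial>P)"
    by (intro nn_integral_cong) (simp add: SUP_mult_right_ennreal)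
  also have "\<dots> = (SUP i. \<integral>\<^sup>+\<omega>. (\<integral>\<^sup>+x. U i x \<partial>\<omega>) * W \<omega> \<partial>P)"
    using seq
    by (intro nn_integral_monotone_convergence_SUP_AE AE_I2 mult_right_mono nn_integral_mono le)
       auto
  also have "\<dots> = (SUP i. \<integral>\<^sup>+x. U i x * w x \<partial>M)"
    by (simp add: seq)
  also have "\<dots> = (\<integral>\<^sup>+x. (SUP i. U i x * w x) \<partial>M)"
    using seq
    by (intro nn_integral_monotone_convergence_SUP_AE [symmetric] AE_I2 mult_right_mono le) auto
  also have "\<dots> = (\<integral>\<^sup>+x. (SUP i. U i) x * w x \<partial>M)"
    by (simp add: SUP_mult_right_ennreal image_comp)
  finally show ?case .
qed

end

section \<open>Moments of the counts\<close>

context poisson_space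
begin

text \<open>The defining property of the Poisson measure for k = 2, with \<open>A\<close> at index 1
  and \<open>B\<close> at index 2.\<close>

lemma disjoint_counts:
  assumes "A \<in> finite_sets M" "B \<in> finite_sets M" "A \<inter> B = {}"
  shows "indep_vars (\<lambda>_. borel) (\<lambda>i \<omega>. emeasure \<omega> (if i = 1 then A else B)) {1..2 :: nat}"
    and "prob {\<omega> \<in> space P. emeasure \<omega> A = of_nat n} = measure M A ^ n / fact n * exp (- measure M A)"
proof -
  let ?F = "\<lambda>i :: nat. if i = 1 then A else B"
  have "?F ` {1..2} \<subseteq> finite_sets M" "disjoint_family_on ?F {1..2}"
    using assms by (auto simp: disjoint_family_on_def)
  with poisson have *: "indep_vars (\<lambda>_. borel) (\<lambda>i \<omega>. emeasure \<omega> (?F i)) {1..2 :: nat}"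
    "\<And>i n. i \<in> {1..2} \<Longrightarrow> prob {\<omega> \<in> space P. emeasure \<omega> (?F i) = of_nat n} =
       measure M (?F i) ^ n / fact n * exp (- measure M (?F i))"
    unfolding is_poisson_measure_def by blast+
  show "indep_vars (\<lambda>_. borel) (\<lambda>i \<omega>. emeasure \<omega> (?F i)) {1..2 :: nat}"
    by (rule *)
  show "prob {\<omega> \<in> space P. emeasure \<omega> A = of_nat n} = measure M A ^ n / fact n * exp (- measure M A)"
    using *(2) [of 1 n] by simp
qed

lemma finite_sets_Diff: "A \<in> finite_sets M \<Longrightarrow> B \<in> finite_sets M \<Longrightarrow> A - B \<in> finite_sets M"
  using emeasure_mono [of "A - B" A M] by (auto simp: finite_sets_def intro: le_less_trans)

lemma finite_sets_Int: "A \<in> finite_sets M \<Longrightarrow> B \<in> finite_sets M \<Longrightarrow> A \<inter> B \<in> finite_sets M"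
  using emeasure_mono [of "A \<inter> B" A M] by (auto simp: finite_sets_def intro: le_less_trans)

lemma sets_finite_sets [measurable_dest]: "A \<in> finite_sets M \<Longrightarrow> A \<in> sets M"
  by (simp add: finite_sets_def)

lemma prob_count:
  assumes "A \<in> finite_sets M"
  shows "prob {\<omega> \<in> space P. emeasure \<omega> A = of_nat n} = measure M A ^ n / fact n * exp (- measure M A)"
proof (rule disjoint_counts)
  \<comment> \<open>The empty set is the disjoint partner that completes \<open>A\<close> to a
    pair.\<close>
  show "{} \<in> finite_sets M" by (simp add: finite_sets_def)
qed (use assms in auto)

text \<open>Only the probabilities of natural values are prescribed. They add up to 1, which shows
  that the count is almost surely a finite natural number, and the integral becomes a
  series.\<close>

lemma nn_integral_count:
  assumes A: "A \<in> finite_sets M" and \<phi> [measurable]: "\<phi> \<in> borel_measurable borel"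
  shows "(\<integral>\<^sup>+\<omega>. \<phi> (emeasure \<omega> A) \<partial>P) =
    (\<Sum>n. \<phi> (of_nat n) * ennreal (measure M A ^ n / fact n * exp (- measure M A)))"
proof -
  have [measurable]: "A \<in> sets M"
    using A by (simp add: finite_sets_def)
  define E where "E n = {\<omega> \<in> space P. emeasure \<omega> A = of_nat n}" for n
  have E [measurable]: "E n \<in> sets P" for n
    unfolding E_def by measurable
  have disj: "disjoint_family E"
    by (auto simp: disjoint_family_on_def E_def)
  have "(\<lambda>n. prob (E n)) sums prob (\<Union>n. E n)"
    by (intro finite_measure_UNION disj) auto
  moreover have "(\<lambda>n. prob (E n)) sums 1"
    using poisson_mass_sums [of "measure M A"] prob_count [OF A] by (simp add: E_def)
  ultimately have "prob (\<Union>n. E n) = 1"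
    by (rule sums_unique2)
  then have "AE \<omega> in P. \<omega> \<in> (\<Union>n. E n)"
    by (subst AE_in_set_eq_1) auto
  then have "(\<integral>\<^sup>+\<omega>. \<phi> (emeasure \<omega> A) \<partial>P) = (\<integral>\<^sup>+\<omega>. (\<Sum>n. \<phi> (of_nat n) * indicator (E n) \<omega>) \<partial>P)"
  proof (intro nn_integral_cong_AE, eventually_elim)
    case (elim \<omega>)
    then obtain m where m: "\<omega> \<in> E m" by blast
    then have "indicator (E n) \<omega> = (if n = m then 1 else 0 :: ennreal)" for n
      by (auto simp: E_def)
    then have "(\<Sum>n. \<phi> (of_nat n) * indicator (E n) \<omega>) = (\<Sum>n\<in>{m}. \<phi> (of_nat n) * indicator (E n) \<omega>)"
      by (intro suminf_finite) auto
    also have "\<dots> = \<phi> (of_nat m)"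
      using m by simp
    also have "of_nat m = emeasure \<omega> A"
      using m by (simp add: E_def)
    finally show ?case
      by (rule sym)
  qed
  also have "\<dots> = (\<Sum>n. \<integral>\<^sup>+\<omega>. \<phi> (of_nat n) * indicator (E n) \<omega> \<partial>P)"
    by (rule nn_integral_suminf) measurable
  also have "\<dots> = (\<Sum>n. \<phi> (of_nat n) * ennreal (measure M A ^ n / fact n * exp (- measure M A)))"
    by (simp add: nn_integral_cmult emeasure_eq_measure prob_count [OF A, folded E_def])
  finally show ?thesis .
qed

lemma finite_sets_emeasure: "A \<in> finite_sets M \<Longrightarrow> emeasure M A = ennreal (measure M A)"
  by (intro emeasure_eq_ennreal_measure) (auto simp: finite_sets_def)

lemma mean_count:
  assumes "A \<in> finite_sets M"
  shows "(\<integral>\<^sup>+\<omega>. emeasure \<omega> A \<partial>P) = emeasure M A"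
proof -
  have "of_nat n * ennreal (measure M A ^ n / fact n * exp (- measure M A))
      = ennreal (real n * (measure M A ^ n / fact n * exp (- measure M A)))" for n
    unfolding ennreal_of_nat_eq_real_of_nat by (rule ennreal_mult'' [symmetric]) simp
  moreover have "(\<Sum>n. ennreal (real n * (measure M A ^ n / fact n * exp (- measure M A))))
      = ennreal (measure M A)"
    by (intro suminf_ennreal_eq poisson_mean_sums) simp
  ultimately show ?thesis
    using nn_integral_count [OF assms, of "\<lambda>x. x"] finite_sets_emeasure [OF assms] by simp
qed

lemma second_moment_count:
  assumes "A \<in> finite_sets M"
  shows "(\<integral>\<^sup>+\<omega>. (emeasure \<omega> A)\<^sup>2 \<partial>P) = (emeasure M A)\<^sup>2 + emeasure M A"
proof -
  have "(of_nat n)\<^sup>2 * ennreal (measure M A ^ n / fact n * exp (- measure M A))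
      = ennreal ((real n)\<^sup>2 * (measure M A ^ n / fact n * exp (- measure M A)))" for n
    unfolding ennreal_of_nat_eq_real_of_nat ennreal_power [OF of_nat_0_le_iff]
    by (rule ennreal_mult'' [symmetric]) simp
  moreover have "(\<Sum>n. ennreal ((real n)\<^sup>2 * (measure M A ^ n / fact n * exp (- measure M A))))
      = ennreal ((measure M A)\<^sup>2 + measure M A)"
    by (intro suminf_ennreal_eq poisson_second_moment_sums) simp
  ultimately show ?thesis
    using nn_integral_count [OF assms, of "\<lambda>x. x\<^sup>2"] finite_sets_emeasure [OF assms]
    by (simp add: ennreal_power)
qed

lemma indep_counts_product:
  assumes A: "A \<in> finite_sets M" and B: "B \<in> finite_sets M" and "A \<inter> B = {}"
    and [measurable]: "\<phi> \<in> borel_measurable borel" "\<psi> \<in> borel_measurable borel"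
  shows "(\<integral>\<^sup>+\<omega>. \<phi> (emeasure \<omega> A) * \<psi> (emeasure \<omega> B) \<partial>P) =
    (\<integral>\<^sup>+\<omega>. \<phi> (emeasure \<omega> A) \<partial>P) * (\<integral>\<^sup>+\<omega>. \<psi> (emeasure \<omega> B) \<partial>P)"
proof -
  have 12: "{1..2 :: nat} = {1, 2}"
    by auto
  have "indep_vars (\<lambda>_. borel)
      (\<lambda>i \<omega>. (if i = 1 then \<phi> else \<psi>) (emeasure \<omega> (if i = 1 then A else B))) {1..2 :: nat}"
    using disjoint_counts(1) [OF assms(1-3)] by (rule indep_vars_compose2) auto
  from indep_vars_nn_integral [OF _ this] show ?thesis
    by (simp add: 12 del: One_nat_def)
qed

text \<open>Both sets are unions of two of the three disjoint pieces \<open>A - B\<close>,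
  \<open>B - A\<close> and \<open>A \<inter> B\<close>. Products of counts of different pieces
  factor by independence; only the square of the common piece produces an extra term, its
  measure.\<close>

lemma product_moment_count:
  assumes A: "A \<in> finite_sets M" and B: "B \<in> finite_sets M"
  shows "(\<integral>\<^sup>+\<omega>. emeasure \<omega> A * emeasure \<omega> B \<partial>P)
    = emeasure M A * emeasure M B + emeasure M (A \<inter> B)"
proof -
  let ?a = "A - B" and ?b = "B - A" and ?c = "A \<inter> B"
  have fin: "?a \<in> finite_sets M" "?b \<in> finite_sets M" "?c \<in> finite_sets M"
    using A B by (auto intro: finite_sets_Diff finite_sets_Int)
  note [measurable] = fin [THEN sets_finite_sets]
  have disj: "?a \<inter> ?b = {}" "?a \<inter> ?c = {}" "?c \<inter> ?b = {}"
    by auto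
  have A_eq: "emeasure N A = emeasure N ?a + emeasure N ?c" if "sets N = sets M" for N
    using that A B by (subst plus_emeasure) (auto simp: Un_Diff_Int finite_sets_def)
  have B_eq: "emeasure N B = emeasure N ?b + emeasure N ?c" if "sets N = sets M" for N
    using that A B by (subst plus_emeasure) (auto simp: finite_sets_def intro!: arg_cong [where f = "emeasure N"])
  have indep: "(\<integral>\<^sup>+\<omega>. emeasure \<omega> C * emeasure \<omega> D \<partial>P) = emeasure M C * emeasure M D"
    if "C \<in> finite_sets M" "D \<in> finite_sets M" "C \<inter> D = {}" for C D
    using indep_counts_product [OF that, of "\<lambda>x. x" "\<lambda>x. x"] that by (simp add: mean_count)
  have "(\<integral>\<^sup>+\<omega>. emeasure \<omega> A * emeasure \<omega> B \<partial>P) =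
      (\<integral>\<^sup>+\<omega>. emeasure \<omega> ?a * emeasure \<omega> ?b + emeasure \<omega> ?a * emeasure \<omega> ?c
        + emeasure \<omega> ?c * emeasure \<omega> ?b + (emeasure \<omega> ?c)\<^sup>2 \<partial>P)"
    by (intro nn_integral_cong) (simp add: A_eq B_eq sets_config algebra_simps power2_eq_square)
  also have "\<dots> = emeasure M ?a * emeasure M ?b + emeasure M ?a * emeasure M ?c
        + emeasure M ?c * emeasure M ?b + ((emeasure M ?c)\<^sup>2 + emeasure M ?c)"
    using indep [OF fin(1) fin(2) disj(1)] indep [OF fin(1) fin(3) disj(2)]
      indep [OF fin(3) fin(2) disj(3)] second_moment_count [OF fin(3)]
    by (simp add: nn_integral_add)
  also have "\<dots> = emeasure M A * emeasure M B + emeasure M ?c"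
    by (simp add: A_eq B_eq algebra_simps power2_eq_square)
  finally show ?thesis .
qed

text \<open>The Poisson mass at 0, posed as an integral of \<open>indicator {0}\<close> of the count
  so that it can appear as a factor in \<open>indep_counts_product\<close>.\<close>

lemma void_probability:
  assumes "A \<in> finite_sets M"
  shows "(\<integral>\<^sup>+\<omega>. indicator {0} (emeasure \<omega> A) \<partial>P) = ennreal (exp (- measure M A))"
proof -
  have [measurable]: "A \<in> sets M"
    using assms by (simp add: finite_sets_def)
  have "(\<integral>\<^sup>+\<omega>. indicator {0} (emeasure \<omega> A) \<partial>P)
      = (\<integral>\<^sup>+\<omega>. indicator {\<omega> \<in> space P. emeasure \<omega> A = 0} \<omega> \<partial>P)"
    by (intro nn_integral_cong) (simp add: indicator_def)
  also have "\<dots> = emeasure P {\<omega> \<in> space P. emeasure \<omega> A = 0}"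
    by (rule nn_integral_indicator) measurable
  finally show ?thesis
    using prob_count [OF assms, of 0] by (simp add: emeasure_eq_measure)
qed

section \<open>Campbell formulas of first and second order\<close>

lemma campbell:
  assumes "f \<in> borel_measurable M"
  shows "(\<integral>\<^sup>+\<omega>. (\<integral>\<^sup>+x. f x \<partial>\<omega>) \<partial>P) = (\<integral>\<^sup>+x. f x \<partial>M)"
proof -
  have "(\<integral>\<^sup>+\<omega>. (\<integral>\<^sup>+x. f x \<partial>\<omega>) * 1 \<partial>P) = (\<integral>\<^sup>+x. f x * 1 \<partial>M)"
    by (rule weighted_campbell) (simp_all add: mean_count sets_finite_sets assms)
  then show ?thesis
    by simp
qed

text \<open>Conditioned on \<open>B\<close> being empty, the configuration is a Poisson process with
  intensity restricted to the complement of \<open>B\<close>; the exponential is the probability of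
  that condition.\<close>

lemma campbell_void:
  assumes B: "B \<in> finite_sets M" and [measurable]: "f \<in> borel_measurable M"
  shows "(\<integral>\<^sup>+\<omega>. (\<integral>\<^sup>+x. f x \<partial>\<omega>) * indicator {0} (emeasure \<omega> B) \<partial>P) =
    ennreal (exp (- measure M B)) * (\<integral>\<^sup>+x. f x * indicator (space M - B) x \<partial>M)"
proof -
  have [measurable]: "B \<in> sets M"
    using B by (simp add: finite_sets_def)
  have "(\<integral>\<^sup>+\<omega>. (\<integral>\<^sup>+x. f x \<partial>\<omega>) * indicator {0} (emeasure \<omega> B) \<partial>P) =
      (\<integral>\<^sup>+x. f x * (ennreal (exp (- measure M B)) * indicator (space M - B) x) \<partial>M)"
  proof (rule weighted_campbell)
    fix A assume A: "A \<in> finite_sets M"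
    then have [measurable]: "A \<in> sets M"
      by (simp add: finite_sets_def)
    \<comment> \<open>On the void event the counts of \<open>A\<close> and of \<open>A - B\<close>
      agree, and the latter set is disjoint from \<open>B\<close>, which gives independence.\<close>
    have "(\<integral>\<^sup>+\<omega>. emeasure \<omega> A * indicator {0} (emeasure \<omega> B) \<partial>P)
        = (\<integral>\<^sup>+\<omega>. emeasure \<omega> (A - B) * indicator {0} (emeasure \<omega> B) \<partial>P)"
    proof (rule nn_integral_cong)
      fix \<omega> assume \<omega>: "\<omega> \<in> space P"
      have "emeasure \<omega> A = emeasure \<omega> (A - B)" if "emeasure \<omega> B = 0"
        using that \<omega> by (intro emeasure_Diff_null_set [symmetric]) (auto simp: null_sets_def sets_config)
      then show "emeasure \<omega> A * indicator {0} (emeasure \<omega> B) =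
          emeasure \<omega> (A - B) * indicator {0} (emeasure \<omega> B)"
        by (auto simp: indicator_def)
    qed
    also have "\<dots> = emeasure M (A - B) * ennreal (exp (- measure M B))"
      using indep_counts_product [OF finite_sets_Diff [OF A B] B, of "\<lambda>x. x" "indicator {0}"]
        mean_count [OF finite_sets_Diff [OF A B]] void_probability [OF B]
      by (simp add: Int_commute)
    also have "\<dots> = ennreal (exp (- measure M B)) * (\<integral>\<^sup>+x. indicator (A - B) x \<partial>M)"
      by (simp add: mult.commute)
    also have "\<dots> = (\<integral>\<^sup>+x. ennreal (exp (- measure M B)) * indicator (A - B) x \<partial>M)"
      by (intro nn_integral_cmult [symmetric]) measurable
    also have "\<dots> = (\<integral>\<^sup>+x. indicator A x * (ennreal (exp (- measure M B)) * indicator (space M - B) x) \<partial>M)"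
      by (intro nn_integral_cong) (auto simp: indicator_def)
    finally show "(\<integral>\<^sup>+\<omega>. emeasure \<omega> A * indicator {0} (emeasure \<omega> B) \<partial>P) = \<dots>" .
  qed measurable
  also have "\<dots> = (\<integral>\<^sup>+x. ennreal (exp (- measure M B)) * (f x * indicator (space M - B) x) \<partial>M)"
    by (intro nn_integral_cong) (simp add: mult_ac)
  also have "\<dots> = ennreal (exp (- measure M B)) * (\<integral>\<^sup>+x. f x * indicator (space M - B) x \<partial>M)"
    by (intro nn_integral_cmult) measurable
  finally show ?thesis .
qed

text \<open>Bilinear extension of \<open>product_moment_count\<close> in two passes of
  \<open>weighted_campbell\<close>: first from sets to \<open>g\<close> with the count of a fixed
  set as weight, then from sets to \<open>f\<close> with the integral of \<open>g\<close> as
  weight.\<close>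

lemma campbell_product:
  assumes [measurable]: "f \<in> borel_measurable M" "g \<in> borel_measurable M"
  shows "(\<integral>\<^sup>+\<omega>. (\<integral>\<^sup>+x. f x \<partial>\<omega>) * (\<integral>\<^sup>+x. g x \<partial>\<omega>) \<partial>P) =
    (\<integral>\<^sup>+x. f x \<partial>M) * (\<integral>\<^sup>+x. g x \<partial>M) + (\<integral>\<^sup>+x. f x * g x \<partial>M)"
proof -
  have *: "(\<integral>\<^sup>+\<omega>. (\<integral>\<^sup>+x. g x \<partial>\<omega>) * emeasure \<omega> A \<partial>P) =
      (\<integral>\<^sup>+x. g x * (emeasure M A + indicator A x) \<partial>M)" if A: "A \<in> finite_sets M" for A
  proof (rule weighted_campbell)
    have [measurable]: "A \<in> sets M"
      using A by (simp add: finite_sets_def)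
    show "(\<lambda>\<omega>. emeasure \<omega> A) \<in> borel_measurable P"
      "(\<lambda>x. emeasure M A + indicator A x) \<in> borel_measurable M"
      by measurable
    fix B assume B: "B \<in> finite_sets M"
    then have [measurable]: "B \<in> sets M"
      by (simp add: finite_sets_def)
    have "(\<integral>\<^sup>+x. indicator B x * (emeasure M A + indicator A x) \<partial>M)
        = (\<integral>\<^sup>+x. emeasure M A * indicator B x + indicator (B \<inter> A) x \<partial>M)"
      by (intro nn_integral_cong) (auto simp: indicator_def)
    also have "\<dots> = emeasure M A * emeasure M B + emeasure M (B \<inter> A)"
      by (simp add: nn_integral_add nn_integral_cmult)
    finally show "(\<integral>\<^sup>+\<omega>. emeasure \<omega> B * emeasure \<omega> A \<partial>P) =
        (\<integral>\<^sup>+x. indicator B x * (emeasure M A + indicator A x) \<partial>M)"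
      using product_moment_count [OF B A] by (simp add: mult.commute)
  qed measurable
  \<comment> \<open>Second pass: the integral of \<open>g\<close> as weight has density
    \<open>(\<integral>\<^sup>+x. g x \<partial>M) + g x\<close>; the second summand records that an
    added point also contributes to the weight.\<close>
  have "(\<integral>\<^sup>+\<omega>. (\<integral>\<^sup>+x. f x \<partial>\<omega>) * (\<integral>\<^sup>+x. g x \<partial>\<omega>) \<partial>P) =
      (\<integral>\<^sup>+x. f x * ((\<integral>\<^sup>+x. g x \<partial>M) + g x) \<partial>M)"
  proof (rule weighted_campbell)
    fix A assume A: "A \<in> finite_sets M"
    then have [measurable]: "A \<in> sets M"
      by (simp add: finite_sets_def)
    have "(\<integral>\<^sup>+\<omega>. emeasure \<omega> A * (\<integral>\<^sup>+x. g x \<partial>\<omega>) \<partial>P) =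
      (\<integral>\<^sup>+x. emeasure M A * g x + indicator A x * g x \<partial>M)"
      using * [OF A] by (simp add: algebra_simps)
    also have "\<dots> = emeasure M A * (\<integral>\<^sup>+x. g x \<partial>M) + (\<integral>\<^sup>+x. indicator A x * g x \<partial>M)"
      by (simp add: nn_integral_add nn_integral_cmult)
    also have "\<dots> = (\<integral>\<^sup>+x. g x \<partial>M) * emeasure M A + (\<integral>\<^sup>+x. indicator A x * g x \<partial>M)"
      by (simp only: mult.commute)
    also have "\<dots> = (\<integral>\<^sup>+x. (\<integral>\<^sup>+x. g x \<partial>M) * indicator A x + indicator A x * g x \<partial>M)"
      by (simp add: nn_integral_add nn_integral_cmult)
    finally show "(\<integral>\<^sup>+\<omega>. emeasure \<omega> A * (\<integral>\<^sup>+x. g x \<partial>\<omega>) \<partial>P) =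
        (\<integral>\<^sup>+x. indicator A x * ((\<integral>\<^sup>+x. g x \<partial>M) + g x) \<partial>M)"
      by (simp add: algebra_simps)
  qed measurable
  also have "\<dots> = (\<integral>\<^sup>+x. (\<integral>\<^sup>+x. g x \<partial>M) * f x + f x * g x \<partial>M)"
    by (simp add: algebra_simps)
  also have "\<dots> = (\<integral>\<^sup>+x. g x \<partial>M) * (\<integral>\<^sup>+x. f x \<partial>M) + (\<integral>\<^sup>+x. f x * g x \<partial>M)"
    by (simp add: nn_integral_add nn_integral_cmult)
  finally show ?thesis
    by (simp only: mult.commute)
qed

end

section \<open>Compensated sums of integrable functions\<close>

text \<open>The variance of the absolute value is nonnegative.\<close>

lemma (in prob_space) expectation_abs_le_sqrt:
  fixes X :: "'a \<Rightarrow> real"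
  assumes "integrable M X" "integrable M (\<lambda>x. (X x)\<^sup>2)"
  shows "expectation (\<lambda>x. \<bar>X x\<bar>) \<le> sqrt (expectation (\<lambda>x. (X x)\<^sup>2))"
proof (rule real_le_rsqrt)
  have "0 \<le> variance (\<lambda>x. \<bar>X x\<bar>)"
    by (rule variance_positive)
  also have "\<dots> = expectation (\<lambda>x. \<bar>X x\<bar>\<^sup>2) - (expectation (\<lambda>x. \<bar>X x\<bar>))\<^sup>2"
    using assms by (intro variance_eq) simp_all
  finally show "(expectation (\<lambda>x. \<bar>X x\<bar>))\<^sup>2 \<le> expectation (\<lambda>x. (X x)\<^sup>2)"
    by simp
qed

context poisson_space
begin

text \<open>Applied to a truncation, this is the expression under the limit that defines
  \<open>I\<^sub>1\<close>.\<close>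

definition compensated_sum :: "('a \<Rightarrow> real) \<Rightarrow> 'a measure \<Rightarrow> real" where
  "compensated_sum f \<omega> = random_sum f \<omega> - (\<integral>x. f x \<partial>M)"

lemma measurable_random_sum [measurable (raw)]:
  assumes [measurable]: "f \<in> borel_measurable M"
  shows "random_sum f \<in> borel_measurable P"
proof -
  \<comment> \<open>The integral takes the default value 0 on configurations where \<open>f\<close>
    is not integrable, so measurability needs a case split on a measurable event.\<close>
  have "random_sum f \<omega> = (if (\<integral>\<^sup>+x. ennreal \<bar>f x\<bar> \<partial>\<omega>) < \<infinity>
      then enn2real (\<integral>\<^sup>+x. ennreal (f x) \<partial>\<omega>) - enn2real (\<integral>\<^sup>+x. ennreal (- f x) \<partial>\<omega>) else 0)"
    if "\<omega> \<in> space P" for \<omega>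
    using that assms
    by (auto simp: random_sum_def real_lebesgue_integral_def not_integrable_integral_eq
        integrable_iff_bounded measurable_config_iff)
  then show ?thesis
    by (simp cong: measurable_cong)
qed

lemma measurable_compensated_sum [measurable (raw)]:
  "f \<in> borel_measurable M \<Longrightarrow> compensated_sum f \<in> borel_measurable P"
  unfolding compensated_sum_def [abs_def] by (intro borel_measurable_diff measurable_random_sum) auto

text \<open>By Campbell's formula the integral of the absolute value over a random configuration has
  finite expectation, hence is almost surely finite.\<close>

lemma AE_integrable_config:
  fixes f :: "'a \<Rightarrow> real"
  assumes f: "integrable M f"
  shows "AE \<omega> in P. integrable \<omega> f"
proof -
  have [measurable]: "f \<in> borel_measurable M"
    using f by simp
  have "(\<integral>\<^sup>+\<omega>. (\<integral>\<^sup>+x. ennreal \<bar>f x\<bar> \<partial>\<omega>) \<partial>P) \<noteq> \<infinity>"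
    using f by (subst campbell) (auto simp: integrable_iff_bounded)
  then have "AE \<omega> in P. (\<integral>\<^sup>+x. ennreal \<bar>f x\<bar> \<partial>\<omega>) \<noteq> \<infinity>"
    by (intro nn_integral_PInf_AE) measurable
  moreover have "AE \<omega> in P. \<omega> \<in> space P"
    by simp
  ultimately show ?thesis
  proof eventually_elim
    case (elim \<omega>)
    then show ?case
      using f by (simp add: integrable_iff_bounded measurable_config_iff top.not_eq_extremum)
  qed
qed

lemma integrable_random_sum:
  assumes f: "integrable M f"
  shows "integrable P (random_sum f)"
    and "expectation (\<lambda>\<omega>. \<bar>random_sum f \<omega>\<bar>) \<le> (\<integral>x. \<bar>f x\<bar> \<partial>M)"
proof -
  have [measurable]: "f \<in> borel_measurable M"
    using f by simp
  have "(\<integral>\<^sup>+\<omega>. ennreal \<bar>random_sum f \<omega>\<bar> \<partial>P) \<le> (\<integral>\<^sup>+\<omega>. (\<integral>\<^sup>+x. ennreal \<bar>f x\<bar> \<partial>\<omega>) \<partial>P)"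
  proof (rule nn_integral_mono_AE)
    show "AE \<omega> in P. ennreal \<bar>random_sum f \<omega>\<bar> \<le> (\<integral>\<^sup>+x. ennreal \<bar>f x\<bar> \<partial>\<omega>)"
      using AE_integrable_config [OF f]
    proof eventually_elim
      case (elim \<omega>)
      then show ?case
        using integral_norm_bound_ennreal [of \<omega> f] by (simp add: random_sum_def)
    qed
  qed
  also have "\<dots> = ennreal (\<integral>x. \<bar>f x\<bar> \<partial>M)"
    using f by (subst campbell) (auto simp: nn_integral_eq_integral)
  finally have *: "(\<integral>\<^sup>+\<omega>. ennreal \<bar>random_sum f \<omega>\<bar> \<partial>P) \<le> ennreal (\<integral>x. \<bar>f x\<bar> \<partial>M)" .
  then show int: "integrable P (random_sum f)"
    by (intro integrableI_bounded) (auto intro: le_less_trans)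
  then show "expectation (\<lambda>\<omega>. \<bar>random_sum f \<omega>\<bar>) \<le> (\<integral>x. \<bar>f x\<bar> \<partial>M)"
    using * by (simp add: nn_integral_eq_integral)
qed

lemma integrable_compensated_sum:
  "integrable M f \<Longrightarrow> integrable P (compensated_sum f)"
  unfolding compensated_sum_def [abs_def] by (simp add: integrable_random_sum)

lemma AE_random_sum_nonneg:
  assumes "integrable M f" "\<And>x. 0 \<le> f x"
  shows "AE \<omega> in P. ennreal (random_sum f \<omega>) = (\<integral>\<^sup>+x. ennreal (f x) \<partial>\<omega>)"
  using AE_integrable_config [OF assms(1)]
  by eventually_elim (simp add: random_sum_def nn_integral_eq_integral assms(2))

lemma random_sum_nonneg: "(\<And>x. 0 \<le> f x) \<Longrightarrow> 0 \<le> random_sum f \<omega>"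
  by (simp add: random_sum_def)

lemma AE_random_sum_diff:
  assumes "integrable M f" "integrable M g"
  shows "AE \<omega> in P. random_sum (\<lambda>x. f x - g x) \<omega> = random_sum f \<omega> - random_sum g \<omega>"
  using AE_integrable_config [OF assms(1)] AE_integrable_config [OF assms(2)]
  by eventually_elim (simp add: random_sum_def)

lemma AE_compensated_sum_diff:
  assumes "integrable M f" "integrable M g"
  shows "AE \<omega> in P. compensated_sum (\<lambda>x. f x - g x) \<omega> = compensated_sum f \<omega> - compensated_sum g \<omega>"
  using AE_random_sum_diff [OF assms] by eventually_elim (simp add: compensated_sum_def assms)

text \<open>Transfers a weighted Campbell formula from nonnegative to signed functions by splitting
  into positive and negative parts. Weights between 0 and 1 preserve integrability on both
  sides.\<close>

lemma expectation_weighted_random_sum: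
  assumes [measurable]: "W \<in> borel_measurable P" "w \<in> borel_measurable M"
    and W: "\<And>\<omega>. 0 \<le> W \<omega>" "\<And>\<omega>. W \<omega> \<le> 1" and w: "\<And>x. 0 \<le> w x" "\<And>x. w x \<le> 1"
    and eq: "\<And>f. f \<in> borel_measurable M \<Longrightarrow>
      (\<integral>\<^sup>+\<omega>. (\<integral>\<^sup>+x. f x \<partial>\<omega>) * ennreal (W \<omega>) \<partial>P) = (\<integral>\<^sup>+x. f x * ennreal (w x) \<partial>M)"
    and f: "integrable M f"
  shows "expectation (\<lambda>\<omega>. random_sum f \<omega> * W \<omega>) = (\<integral>x. f x * w x \<partial>M)"
proof -
  have intW: "integrable P (\<lambda>\<omega>. random_sum g \<omega> * W \<omega>)" if "integrable M g" for g
    using W by (intro Bochner_Integration.integrable_bound [OF integrable_random_sum(1) [OF that]] AE_I2)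
      (use that in \<open>auto simp: abs_mult intro!: mult_left_le\<close>)
  have intw: "integrable M (\<lambda>x. g x * w x)" if "integrable M g" for g
    using w by (intro Bochner_Integration.integrable_bound [OF that] AE_I2)
      (use that in \<open>auto simp: abs_mult intro!: mult_left_le\<close>)
  have *: "expectation (\<lambda>\<omega>. random_sum g \<omega> * W \<omega>) = (\<integral>x. g x * w x \<partial>M)"
    if g: "integrable M g" "\<And>x. 0 \<le> g x" for g
  proof -
    have [measurable]: "g \<in> borel_measurable M"
      using g by simp
    have "(\<integral>\<^sup>+\<omega>. ennreal (random_sum g \<omega> * W \<omega>) \<partial>P)
        = (\<integral>\<^sup>+\<omega>. (\<integral>\<^sup>+x. ennreal (g x) \<partial>\<omega>) * ennreal (W \<omega>) \<partial>P)"
      using AE_random_sum_nonneg [OF g]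
      by (intro nn_integral_cong_AE) (auto simp: ennreal_mult'' W)
    also have "\<dots> = (\<integral>\<^sup>+x. ennreal (g x * w x) \<partial>M)"
      by (subst eq) (simp_all add: ennreal_mult'' w)
    finally show ?thesis
      using g W w by (subst (1 2) integral_eq_nn_integral) (auto simp: random_sum_nonneg)
  qed
  define p n where "p x = max 0 (f x)" and "n x = max 0 (- f x)" for x
  have int: "integrable M p" "integrable M n"
    using f by (auto simp: p_def n_def [abs_def] p_def [abs_def])
  have f_eq: "f = (\<lambda>x. p x - n x)"
    by (auto simp: p_def n_def)
  have "expectation (\<lambda>\<omega>. random_sum f \<omega> * W \<omega>)
      = expectation (\<lambda>\<omega>. random_sum p \<omega> * W \<omega> - random_sum n \<omega> * W \<omega>)"
  proof (rule integral_cong_AE)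
    show "AE \<omega> in P. random_sum f \<omega> * W \<omega> = random_sum p \<omega> * W \<omega> - random_sum n \<omega> * W \<omega>"
      using AE_random_sum_diff [OF int] unfolding f_eq [symmetric]
      by eventually_elim (simp flip: left_diff_distrib)
  qed (use f int in measurable)
  also have "\<dots> = (\<integral>x. p x * w x \<partial>M) - (\<integral>x. n x * w x \<partial>M)"
    using int by (simp add: intW *) (simp add: * p_def n_def)
  also have "\<dots> = (\<integral>x. f x * w x \<partial>M)"
    using int by (simp add: f_eq left_diff_distrib intw)
  finally show ?thesis .
qed

lemma expectation_random_sum:
  assumes "integrable M f"
  shows "expectation (random_sum f) = (\<integral>x. f x \<partial>M)"
proof -
  have "expectation (\<lambda>\<omega>. random_sum f \<omega> * 1) = (\<integral>x. f x * 1 \<partial>M)"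
    by (rule expectation_weighted_random_sum) (simp_all add: campbell assms)
  then show ?thesis
    by simp
qed

lemma expectation_void_random_sum:
  assumes f: "integrable M f" and B: "B \<in> finite_sets M"
  shows "expectation (\<lambda>\<omega>. random_sum f \<omega> * indicator {0} (emeasure \<omega> B)) =
    (\<integral>x. f x * (exp (- measure M B) * indicator (space M - B) x) \<partial>M)"
proof (rule expectation_weighted_random_sum)
  have [measurable]: "B \<in> sets M"
    using B by (simp add: finite_sets_def)
  show "(\<lambda>\<omega>. indicat_real {0} (emeasure \<omega> B)) \<in> borel_measurable P"
    "(\<lambda>x. exp (- measure M B) * indicat_real (space M - B) x) \<in> borel_measurable M"
    by measurable
  show "exp (- measure M B) * indicat_real (space M - B) x \<le> 1" for x
    by (auto simp: indicator_def)
  fix g :: "'a \<Rightarrow> ennreal" assume [measurable]: "g \<in> borel_measurable M"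
  have "(\<integral>\<^sup>+x. g x * ennreal (exp (- measure M B) * indicator (space M - B) x) \<partial>M)
      = (\<integral>\<^sup>+x. ennreal (exp (- measure M B)) * (g x * indicator (space M - B) x) \<partial>M)"
    by (intro nn_integral_cong) (auto simp: indicator_def mult.commute)
  also have "\<dots> = ennreal (exp (- measure M B)) * (\<integral>\<^sup>+x. g x * indicator (space M - B) x \<partial>M)"
    by (intro nn_integral_cmult) measurable
  also have "\<dots> = (\<integral>\<^sup>+\<omega>. (\<integral>\<^sup>+x. g x \<partial>\<omega>) * indicator {0} (emeasure \<omega> B) \<partial>P)"
    using B by (intro campbell_void [symmetric]) measurable
  also have "\<dots> = (\<integral>\<^sup>+\<omega>. (\<integral>\<^sup>+x. g x \<partial>\<omega>) * ennreal (indicator {0} (emeasure \<omega> B)) \<partial>P)"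
    by (intro nn_integral_cong) (auto simp: indicator_def)
  finally show "(\<integral>\<^sup>+\<omega>. (\<integral>\<^sup>+x. g x \<partial>\<omega>) * ennreal (indicator {0} (emeasure \<omega> B)) \<partial>P) =
      (\<integral>\<^sup>+x. g x * ennreal (exp (- measure M B) * indicator (space M - B) x) \<partial>M)"
    by (rule sym)
qed (simp_all add: f)

text \<open>The integral of \<open>f x * g x\<close> is the covariance of the two sums; it comes
  from the points that enter both of them.\<close>

lemma expectation_random_sum_product:
  assumes f: "integrable M f" "\<And>x. 0 \<le> f x" and g: "integrable M g" "\<And>x. 0 \<le> g x"
    and fg: "integrable M (\<lambda>x. f x * g x)"
  shows "integrable P (\<lambda>\<omega>. random_sum f \<omega> * random_sum g \<omega>)"
    and "expectation (\<lambda>\<omega>. random_sum f \<omega> * random_sum g \<omega>) =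
      (\<integral>x. f x \<partial>M) * (\<integral>x. g x \<partial>M) + (\<integral>x. f x * g x \<partial>M)"
proof -
  have [measurable]: "f \<in> borel_measurable M" "g \<in> borel_measurable M"
    using f g by simp_all
  have "(\<integral>\<^sup>+\<omega>. ennreal (random_sum f \<omega> * random_sum g \<omega>) \<partial>P)
      = (\<integral>\<^sup>+\<omega>. (\<integral>\<^sup>+x. ennreal (f x) \<partial>\<omega>) * (\<integral>\<^sup>+x. ennreal (g x) \<partial>\<omega>) \<partial>P)"
    using AE_random_sum_nonneg [OF f] AE_random_sum_nonneg [OF g]
    by (intro nn_integral_cong_AE, eventually_elim)
      (simp add: ennreal_mult random_sum_nonneg f g)
  also have "\<dots> = (\<integral>\<^sup>+x. ennreal (f x) \<partial>M) * (\<integral>\<^sup>+x. ennreal (g x) \<partial>M)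
      + (\<integral>\<^sup>+x. ennreal (f x * g x) \<partial>M)"
    by (subst campbell_product) (simp_all add: ennreal_mult f g)
  also have "\<dots> = ennreal (\<integral>x. f x \<partial>M) * ennreal (\<integral>x. g x \<partial>M)
      + ennreal (\<integral>x. f x * g x \<partial>M)"
    by (simp add: nn_integral_eq_integral f g fg)
  also have "\<dots> = ennreal ((\<integral>x. f x \<partial>M) * (\<integral>x. g x \<partial>M) + (\<integral>x. f x * g x \<partial>M))"
    by (simp add: ennreal_mult f g)
  finally have *: "(\<integral>\<^sup>+\<omega>. ennreal (random_sum f \<omega> * random_sum g \<omega>) \<partial>P)
      = ennreal ((\<integral>x. f x \<partial>M) * (\<integral>x. g x \<partial>M) + (\<integral>x. f x * g x \<partial>M))" .
  show "integrable P (\<lambda>\<omega>. random_sum f \<omega> * random_sum g \<omega>)"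
    using * by (intro integrableI_nonneg) (auto simp: random_sum_nonneg f g)
  show "expectation (\<lambda>\<omega>. random_sum f \<omega> * random_sum g \<omega>) =
      (\<integral>x. f x \<partial>M) * (\<integral>x. g x \<partial>M) + (\<integral>x. f x * g x \<partial>M)"
    using * by (subst integral_eq_nn_integral) (simp_all add: random_sum_nonneg f g del: ennreal_plus)
qed

text \<open>The square is expanded over the positive part \<open>p\<close> and the negative part
  \<open>n\<close>. All products of means cancel against the compensator, and the covariance terms
  that survive are the integrals of \<open>p\<^sup>2\<close> and \<open>n\<^sup>2\<close>.\<close>

lemma compensated_sum_isometry:
  assumes f: "integrable M f" and f2: "integrable M (\<lambda>x. (f x)\<^sup>2)"
  shows "integrable P (\<lambda>\<omega>. (compensated_sum f \<omega>)\<^sup>2)"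
    and "expectation (\<lambda>\<omega>. (compensated_sum f \<omega>)\<^sup>2) = (\<integral>x. (f x)\<^sup>2 \<partial>M)"
proof -
  define p n where "p x = max 0 (f x)" and "n x = max 0 (- f x)" for x
  have [measurable]: "f \<in> borel_measurable M" "p \<in> borel_measurable M" "n \<in> borel_measurable M"
    using f unfolding p_def [abs_def] n_def [abs_def] by simp_all
  have int: "integrable M p" "integrable M n"
    using f unfolding p_def [abs_def] n_def [abs_def] by simp_all
  have f_eq: "f = (\<lambda>x. p x - n x)"
    by (auto simp: p_def n_def)
  have nonneg: "\<And>x. 0 \<le> p x" "\<And>x. 0 \<le> n x"
    by (auto simp: p_def n_def)
  \<comment> \<open>The two parts are never nonzero together, so the mixed covariance is 0 and the
    product formula applies to unbounded \<open>p\<close> and \<open>n\<close> too.\<close>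
  have pn: "(\<lambda>x. p x * n x) = (\<lambda>_. 0)"
    by (auto simp: p_def n_def max_def fun_eq_iff)
  have int2: "integrable M (\<lambda>x. p x * p x)" "integrable M (\<lambda>x. n x * n x)"
    by (rule Bochner_Integration.integrable_bound [OF f2];
        auto simp: p_def n_def power2_eq_square max_def)+
  note pp = expectation_random_sum_product [OF int(1) nonneg(1) int(1) nonneg(1) int2(1)]
  note nn = expectation_random_sum_product [OF int(2) nonneg(2) int(2) nonneg(2) int2(2)]
  note pn' = expectation_random_sum_product [OF int(1) nonneg(1) int(2) nonneg(2), unfolded pn, simplified]
  define m where "m = (\<integral>x. f x \<partial>M)"
  have m: "m = (\<integral>x. p x \<partial>M) - (\<integral>x. n x \<partial>M)"
    using int by (simp add: m_def f_eq)
  let ?Z = "\<lambda>\<omega>. random_sum p \<omega> * random_sum p \<omega> + random_sum n \<omega> * random_sum n \<omega>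
    - 2 * (random_sum p \<omega> * random_sum n \<omega>) - 2 * m * random_sum f \<omega> + m\<^sup>2"
  have AE: "AE \<omega> in P. (compensated_sum f \<omega>)\<^sup>2 = ?Z \<omega>"
    using AE_random_sum_diff [OF int] unfolding f_eq [symmetric]
    by eventually_elim
      (simp add: compensated_sum_def m_def [symmetric] power2_eq_square left_diff_distrib right_diff_distrib)
  have Z: "integrable P ?Z"
    using pp(1) nn(1) pn'(1) integrable_random_sum(1) [OF f] by simp
  show "integrable P (\<lambda>\<omega>. (compensated_sum f \<omega>)\<^sup>2)"
    by (subst integrable_cong_AE [OF _ _ AE]) (use Z in measurable)
  have "expectation (\<lambda>\<omega>. (compensated_sum f \<omega>)\<^sup>2) = expectation ?Z"
    by (rule integral_cong_AE [OF _ _ AE]) (use Z in measurable)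
  also have "\<dots> = (\<integral>x. p x * p x \<partial>M) + (\<integral>x. n x * n x \<partial>M)"
    using pp nn pn' integrable_random_sum(1) [OF f] expectation_random_sum [OF f]
    by (simp add: m_def [symmetric] prob_space) (simp add: m power2_eq_square algebra_simps)
  also have "\<dots> = (\<integral>x. p x * p x + n x * n x \<partial>M)"
    using int2 by simp
  also have "\<dots> = (\<integral>x. (f x)\<^sup>2 \<partial>M)"
    by (intro Bochner_Integration.integral_cong) (auto simp: p_def n_def power2_eq_square max_def)
  finally show "expectation (\<lambda>\<omega>. (compensated_sum f \<omega>)\<^sup>2) = (\<integral>x. (f x)\<^sup>2 \<partial>M)" .
qed

lemma compensated_sum_L2_bound:
  assumes "integrable M f" "integrable M (\<lambda>x. (f x)\<^sup>2)"
  shows "expectation (\<lambda>\<omega>. \<bar>compensated_sum f \<omega>\<bar>) \<le> sqrt (\<integral>x. (f x)\<^sup>2 \<partial>M)"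
  using expectation_abs_le_sqrt [OF integrable_compensated_sum [OF assms(1)]]
    compensated_sum_isometry [OF assms] by simp

text \<open>The random sum and the subtracted mean each cost at most one \<open>L^1\<close>
  norm.\<close>

lemma compensated_sum_L1_bound:
  assumes f: "integrable M f"
  shows "expectation (\<lambda>\<omega>. \<bar>compensated_sum f \<omega>\<bar>) \<le> 2 * (\<integral>x. \<bar>f x\<bar> \<partial>M)"
proof -
  have "expectation (\<lambda>\<omega>. \<bar>compensated_sum f \<omega>\<bar>)
      \<le> expectation (\<lambda>\<omega>. \<bar>random_sum f \<omega>\<bar> + \<bar>\<integral>x. f x \<partial>M\<bar>)"
    using f by (intro integral_mono) (auto simp: compensated_sum_def integrable_random_sum
      integrable_compensated_sum [unfolded compensated_sum_def [abs_def]])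
  also have "\<dots> = expectation (\<lambda>\<omega>. \<bar>random_sum f \<omega>\<bar>) + \<bar>\<integral>x. f x \<partial>M\<bar>"
    using f by (simp add: integrable_random_sum prob_space)
  also have "\<dots> \<le> 2 * (\<integral>x. \<bar>f x\<bar> \<partial>M)"
    using add_mono [OF integrable_random_sum(2) [OF f] integral_abs_bound [of M f]] by simp
  finally show ?thesis .
qed

lemma compensated_sum_L1_L2_bound:
  assumes f: "integrable M f" and p: "integrable M p" and q [measurable]: "q \<in> borel_measurable M"
    and q2: "integrable M (\<lambda>x. (q x)\<^sup>2)" and eq: "\<And>x. f x = p x + q x"
  shows "expectation (\<lambda>\<omega>. \<bar>compensated_sum f \<omega>\<bar>) \<le> 2 * (\<integral>x. \<bar>p x\<bar> \<partial>M) + sqrt (\<integral>x. (q x)\<^sup>2 \<partial>M)"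
proof -
  have q_eq: "q = (\<lambda>x. f x - p x)"
    using eq by auto
  \<comment> \<open>As a difference of integrable functions the second part is itself integrable,
    which the \<open>L^2\<close> bound requires in addition to square integrability.\<close>
  have q1: "integrable M q"
    using f p by (simp add: q_eq)
  have "AE \<omega> in P. \<bar>compensated_sum f \<omega>\<bar> \<le> \<bar>compensated_sum p \<omega>\<bar> + \<bar>compensated_sum q \<omega>\<bar>"
    using AE_compensated_sum_diff [OF f p] unfolding q_eq [symmetric] by eventually_elim simp
  then have "expectation (\<lambda>\<omega>. \<bar>compensated_sum f \<omega>\<bar>)
      \<le> expectation (\<lambda>\<omega>. \<bar>compensated_sum p \<omega>\<bar> + \<bar>compensated_sum q \<omega>\<bar>)"
    using f p q1 by (intro integral_mono_AE) (auto simp: integrable_compensated_sum)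
  also have "\<dots> = expectation (\<lambda>\<omega>. \<bar>compensated_sum p \<omega>\<bar>) + expectation (\<lambda>\<omega>. \<bar>compensated_sum q \<omega>\<bar>)"
    using p q1 by (simp add: integrable_compensated_sum)
  also have "\<dots> \<le> 2 * (\<integral>x. \<bar>p x\<bar> \<partial>M) + sqrt (\<integral>x. (q x)\<^sup>2 \<partial>M)"
    by (intro add_mono compensated_sum_L1_bound compensated_sum_L2_bound p q1 q2)
  finally show ?thesis .
qed

text \<open>The void indicator of \<open>A\<close> lies between 0 and 1, so testing against it does
  not exceed the \<open>L^1\<close> norm; the constant is the inverse of the void
  probability.\<close>

lemma set_integral_le_compensated_sum:
  assumes f: "integrable M f" and A: "A \<in> finite_sets M"
  shows "\<bar>\<integral>x. f x * indicator A x \<partial>M\<bar> \<le>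
    exp (measure M A) * expectation (\<lambda>\<omega>. \<bar>compensated_sum f \<omega>\<bar>)"
proof -
  have [measurable]: "A \<in> sets M"
    using A by (simp add: finite_sets_def)
  have AM: "A \<subseteq> space M"
    by (rule sets.sets_into_space) simp
  let ?V = "\<lambda>\<omega>. indicat_real {0} (emeasure \<omega> A)" and ?m = "measure M A"
  have V: "integrable P ?V"
    by (rule integrable_const_bound [of _ 1]) auto
  have "expectation ?V = enn2real (\<integral>\<^sup>+\<omega>. ennreal (?V \<omega>) \<partial>P)"
    by (rule integral_eq_nn_integral) auto
  also have "(\<integral>\<^sup>+\<omega>. ennreal (?V \<omega>) \<partial>P) = (\<integral>\<^sup>+\<omega>. indicator {0} (emeasure \<omega> A) \<partial>P)"
    by (intro nn_integral_cong) (auto simp: indicator_def)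
  finally have EV: "expectation ?V = exp (- ?m)"
    by (simp add: void_probability [OF A])
  have fV: "integrable P (\<lambda>\<omega>. random_sum f \<omega> * ?V \<omega>)"
    by (rule Bochner_Integration.integrable_bound [OF integrable_random_sum(1) [OF f]])
      (use f in \<open>auto simp: indicator_def\<close>)
  have "expectation (\<lambda>\<omega>. compensated_sum f \<omega> * ?V \<omega>)
      = expectation (\<lambda>\<omega>. random_sum f \<omega> * ?V \<omega>) - (\<integral>x. f x \<partial>M) * exp (- ?m)"
    using fV V by (simp add: compensated_sum_def left_diff_distrib EV)
  also have "\<dots> = exp (- ?m) * ((\<integral>x. f x * indicator (space M - A) x \<partial>M) - (\<integral>x. f x \<partial>M))"
    by (simp add: expectation_void_random_sum [OF f A] mult.left_commute [of _ "exp (- ?m)"]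
      right_diff_distrib mult.commute [of "exp (- ?m)" "integral\<^sup>L M f"])
  \<comment> \<open>On the void event the random sum sees only the complement of \<open>A\<close>,
    whereas the compensator subtracts the full integral.\<close>
  also have "(\<integral>x. f x * indicator (space M - A) x \<partial>M) - (\<integral>x. f x \<partial>M)
      = (\<integral>x. f x * indicator (space M - A) x - f x \<partial>M)"
    using f by (intro Bochner_Integration.integral_diff [symmetric] integrable_real_mult_indicator) auto
  also have "\<dots> = (\<integral>x. - (f x * indicator A x) \<partial>M)"
    by (intro Bochner_Integration.integral_cong) (auto simp: indicator_def)
  finally have "exp (- ?m) * \<bar>\<integral>x. f x * indicator A x \<partial>M\<bar>
      = \<bar>expectation (\<lambda>\<omega>. compensated_sum f \<omega> * ?V \<omega>)\<bar>"
    by (simp add: abs_mult)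
  also have "\<dots> \<le> expectation (\<lambda>\<omega>. \<bar>compensated_sum f \<omega> * ?V \<omega>\<bar>)"
    by (rule integral_abs_bound)
  also have "\<dots> \<le> expectation (\<lambda>\<omega>. \<bar>compensated_sum f \<omega>\<bar>)"
    using f by (intro integral_mono_AE' AE_I2) (auto simp: integrable_compensated_sum indicator_def)
  finally show ?thesis
    by (simp add: exp_minus field_simps)
qed

end

section \<open>The space \<open>L\<^sup>\<Phi>\<close>\<close>

lemma Phi_nonneg: "0 \<le> x \<Longrightarrow> 0 \<le> Phi x"
  by (simp add: Phi_def)

lemma Phi_le_square: "0 \<le> x \<Longrightarrow> Phi x \<le> x\<^sup>2"
  using zero_le_power2 [of "x - 1"] by (simp add: Phi_def power2_eq_square algebra_simps)

lemma Phi_le_linear: "0 \<le> x \<Longrightarrow> Phi x \<le> 2 * x"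
  by (auto simp: Phi_def power2_eq_square intro: order_trans [OF mult_left_le])

lemma measurable_Phi [measurable]: "Phi \<in> borel_measurable borel"
  unfolding Phi_def [abs_def] by measurable

lemma truncation_eq: "truncation f c x = (if c < \<bar>f x\<bar> then f x else 0)"
  by (simp add: truncation_def)

lemma measurable_truncation [measurable (raw)]:
  assumes [measurable]: "f \<in> borel_measurable M"
  shows "truncation f c \<in> borel_measurable M"
  unfolding truncation_eq [abs_def] by measurable

lemma L_Phi_measurable [measurable_dest]: "f \<in> L_Phi M \<Longrightarrow> f \<in> borel_measurable M"
  by (simp add: L_Phi_def)

lemma L_Phi_integrable_Phi:
  assumes "f \<in> L_Phi M"
  shows "integrable M (\<lambda>x. Phi \<bar>f x\<bar>)"
  using assms by (intro integrableI_nonneg) (auto simp: L_Phi_def Phi_nonneg)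

lemma L_Phi_integrable_truncation:
  assumes f: "f \<in> L_Phi M" and c: "0 < c"
  shows "integrable M (truncation f c)"
proof (rule Bochner_Integration.integrable_bound)
  \<comment> \<open>For c < |f| <= 1 one has |f| <= f^2 / c, and for |f| > 1 one has |f| <= 2 |f| -
    1; the sum of the two constants 1 / c and 1 serves both cases.\<close>
  show "integrable M (\<lambda>x. (1 / c + 1) * Phi \<bar>f x\<bar>)"
    using f by (intro integrable_mult_right L_Phi_integrable_Phi)
  show "AE x in M. norm (truncation f c x) \<le> norm ((1 / c + 1) * Phi \<bar>f x\<bar>)"
  proof (rule AE_I2)
    fix x
    have "\<bar>f x\<bar> \<le> (1 / c + 1) * Phi \<bar>f x\<bar>" if *: "c < \<bar>f x\<bar>"
    proof (cases "\<bar>f x\<bar> \<le> 1")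
      case True
      have "c * \<bar>f x\<bar> \<le> \<bar>f x\<bar> * \<bar>f x\<bar>"
        using * by (intro mult_right_mono) auto
      then have "\<bar>f x\<bar> \<le> 1 / c * Phi \<bar>f x\<bar>"
        using True c by (simp add: Phi_def field_simps power2_eq_square)
      then show ?thesis
        using Phi_nonneg [of "\<bar>f x\<bar>"] by (simp add: distrib_right)
    next
      case False
      then have "\<bar>f x\<bar> \<le> Phi \<bar>f x\<bar>"
        by (simp add: Phi_def)
      moreover have "0 \<le> 1 / c * Phi \<bar>f x\<bar>"
        using c by (intro mult_nonneg_nonneg Phi_nonneg) auto
      ultimately show ?thesis
        unfolding distrib_right by linarith
    qed
    then show "norm (truncation f c x) \<le> norm ((1 / c + 1) * Phi \<bar>f x\<bar>)"
      using c Phi_nonneg [of "\<bar>f x\<bar>"] by (auto simp: truncation_eq)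
  qed
qed (use f in measurable)

lemma L_Phi_integrable_small_part:
  assumes f: "f \<in> L_Phi M" and c: "0 < c"
  shows "integrable M (\<lambda>x. (f x - truncation f c x)\<^sup>2)"
proof (rule Bochner_Integration.integrable_bound)
  \<comment> \<open>Where |f| <= 1 the square is \<open>Phi\<close> itself, constant 1. Where 1 <
    |f| <= c it is at most c^2 while \<open>Phi\<close> is at least 1, constant c^2.\<close>
  show "integrable M (\<lambda>x. (c\<^sup>2 + 1) * Phi \<bar>f x\<bar>)"
    using f by (intro integrable_mult_right L_Phi_integrable_Phi)
  show "AE x in M. norm ((f x - truncation f c x)\<^sup>2) \<le> norm ((c\<^sup>2 + 1) * Phi \<bar>f x\<bar>)"
  proof (rule AE_I2)
    fix x
    have "(f x)\<^sup>2 \<le> (c\<^sup>2 + 1) * Phi \<bar>f x\<bar>" if *: "\<bar>f x\<bar> \<le> c"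
    proof (cases "\<bar>f x\<bar> \<le> 1")
      case True
      then show ?thesis
        by (simp add: Phi_def distrib_right)
    next
      case False
      have "(f x)\<^sup>2 \<le> c\<^sup>2"
        using * abs_le_square_iff [of "f x" c] by simp
      also have "\<dots> \<le> (c\<^sup>2 + 1) * 1"
        by simp
      also have "\<dots> \<le> (c\<^sup>2 + 1) * Phi \<bar>f x\<bar>"
        using False by (intro mult_left_mono) (auto simp: Phi_def)
      finally show ?thesis .
    qed
    then show "norm ((f x - truncation f c x)\<^sup>2) \<le> norm ((c\<^sup>2 + 1) * Phi \<bar>f x\<bar>)"
      using Phi_nonneg [of "\<bar>f x\<bar>"] by (auto simp: truncation_eq)
  qed
qed (use f in measurable)

text \<open>At each point the larger of |p| and |q| dominates the sum up to a factor 2; the linear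
  bound on \<open>Phi\<close> is used if it is |p|, the quadratic one if it is |q|. With
  \<open>L_Phi_decomposition\<close> this gives the description as \<open>L^1 + L^2\<close>.\<close>

lemma L_Phi_sumI:
  assumes p: "integrable M p" and q [measurable]: "q \<in> borel_measurable M"
    and q2: "integrable M (\<lambda>x. (q x)\<^sup>2)"
  shows "(\<lambda>x. p x + q x) \<in> L_Phi M"
proof -
  have [measurable]: "p \<in> borel_measurable M"
    using p by simp
  have "Phi \<bar>p x + q x\<bar> \<le> 4 * \<bar>p x\<bar> + 4 * (q x)\<^sup>2" for x
  proof (cases "\<bar>q x\<bar> \<le> \<bar>p x\<bar>")
    case True
    have "2 * \<bar>p x + q x\<bar> \<le> 4 * \<bar>p x\<bar>"
      using order_trans [OF abs_triangle_ineq add_left_mono [OF True], of "p x"] by simp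
    then have "Phi \<bar>p x + q x\<bar> \<le> 4 * \<bar>p x\<bar>"
      by (rule order_trans [OF Phi_le_linear [OF abs_ge_zero]])
    then show ?thesis
      by (rule order_trans) simp
  next
    case False
    then have "\<bar>p x + q x\<bar> \<le> \<bar>2 * q x\<bar>"
      by linarith
    then have "\<bar>p x + q x\<bar>\<^sup>2 \<le> 4 * (q x)\<^sup>2"
      unfolding abs_le_square_iff by (simp add: power_mult_distrib)
    then show ?thesis
      using Phi_le_square [of "\<bar>p x + q x\<bar>"] by linarith
  qed
  then have "(\<integral>\<^sup>+x. ennreal (Phi \<bar>p x + q x\<bar>) \<partial>M) \<le> (\<integral>\<^sup>+x. ennreal (4 * \<bar>p x\<bar> + 4 * (q x)\<^sup>2) \<partial>M)"
    by (intro nn_integral_mono ennreal_leI)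
  also have "\<dots> < \<infinity>"
    using p q2 by (subst nn_integral_eq_integral) auto
  finally show ?thesis
    by (simp add: L_Phi_def)
qed

lemma integrable_in_L_Phi:
  assumes "integrable M f"
  shows "f \<in> L_Phi M"
  using L_Phi_sumI [OF assms, of "\<lambda>_. 0"] by simp

lemma L_Phi_decomposition:
  assumes "f \<in> L_Phi M"
  obtains p q where "integrable M p" "q \<in> borel_measurable M" "integrable M (\<lambda>x. (q x)\<^sup>2)"
    "f = (\<lambda>x. p x + q x)"
proof
  show "integrable M (truncation f 1)" "integrable M (\<lambda>x. (f x - truncation f 1 x)\<^sup>2)"
    using assms by (auto intro: L_Phi_integrable_truncation L_Phi_integrable_small_part)
  show "(\<lambda>x. f x - truncation f 1 x) \<in> borel_measurable M"
    using assms by measurable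
qed auto

lemma integrable_square_add:
  fixes f g :: "'a \<Rightarrow> real"
  assumes [measurable]: "f \<in> borel_measurable M" "g \<in> borel_measurable M"
    and "integrable M (\<lambda>x. (f x)\<^sup>2)" "integrable M (\<lambda>x. (g x)\<^sup>2)"
  shows "integrable M (\<lambda>x. (f x + g x)\<^sup>2)"
    and "(\<integral>x. (f x + g x)\<^sup>2 \<partial>M) \<le> 2 * (\<integral>x. (f x)\<^sup>2 \<partial>M) + 2 * (\<integral>x. (g x)\<^sup>2 \<partial>M)"
proof -
  have le: "(f x + g x)\<^sup>2 \<le> 2 * (f x)\<^sup>2 + 2 * (g x)\<^sup>2" for x
    using zero_le_power2 [of "f x - g x"] by (simp add: power2_eq_square algebra_simps)
  have int: "integrable M (\<lambda>x. 2 * (f x)\<^sup>2 + 2 * (g x)\<^sup>2)"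
    using assms by simp
  show 1: "integrable M (\<lambda>x. (f x + g x)\<^sup>2)"
    by (rule Bochner_Integration.integrable_bound [OF int])
      (auto intro!: order_trans [OF le])
  show "(\<integral>x. (f x + g x)\<^sup>2 \<partial>M) \<le> 2 * (\<integral>x. (f x)\<^sup>2 \<partial>M) + 2 * (\<integral>x. (g x)\<^sup>2 \<partial>M)"
    using integral_mono [OF 1 int le] assms by simp
qed

lemma L_Phi_add:
  assumes "f \<in> L_Phi M" "g \<in> L_Phi M"
  shows "(\<lambda>x. f x + g x) \<in> L_Phi M"
proof -
  obtain p q where 1: "integrable M p" "q \<in> borel_measurable M" "integrable M (\<lambda>x. (q x)\<^sup>2)"
    "f = (\<lambda>x. p x + q x)"
    using assms L_Phi_decomposition by blast
  obtain p' q' where 2: "integrable M p'" "q' \<in> borel_measurable M" "integrable M (\<lambda>x. (q' x)\<^sup>2)"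
    "g = (\<lambda>x. p' x + q' x)"
    using assms L_Phi_decomposition by blast
  have "(\<lambda>x. (p x + p' x) + (q x + q' x)) \<in> L_Phi M"
    using 1 2 by (intro L_Phi_sumI integrable_square_add) auto
  also have "(\<lambda>x. (p x + p' x) + (q x + q' x)) = (\<lambda>x. f x + g x)"
    by (auto simp: 1 2)
  finally show ?thesis .
qed

lemma L_Phi_cmult:
  assumes "f \<in> L_Phi M"
  shows "(\<lambda>x. c * f x) \<in> L_Phi M"
proof -
  obtain p q where 1: "integrable M p" "q \<in> borel_measurable M" "integrable M (\<lambda>x. (q x)\<^sup>2)"
    "f = (\<lambda>x. p x + q x)"
    using assms L_Phi_decomposition by blast
  have "(\<lambda>x. c * p x + c * q x) \<in> L_Phi M"
    using 1 by (intro L_Phi_sumI) (auto simp: power_mult_distrib)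
  then show ?thesis
    by (simp add: 1 distrib_left)
qed

lemma small_part_tendsto_0:
  assumes f: "f \<in> L_Phi M"
  shows "((\<lambda>\<epsilon>. \<integral>x. (f x - truncation f \<epsilon> x)\<^sup>2 \<partial>M) \<longlongrightarrow> 0) (at_right 0)"
\<comment> \<open>The bound 1 keeps every level below 1, so the small part at level 1 dominates all
  the others.\<close>
proof (rule tendsto_at_right_sequentially [of 0 1])
  fix S :: "nat \<Rightarrow> real"
  assume S: "\<And>n. 0 < S n" "\<And>n. S n < 1" "decseq S" "S \<longlonglongrightarrow> 0"
  have [measurable]: "f \<in> borel_measurable M"
    using f by measurable
  have "(\<lambda>n. \<integral>x. (f x - truncation f (S n) x)\<^sup>2 \<partial>M) \<longlonglongrightarrow> (\<integral>x. 0 \<partial>M)"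
  proof (rule integral_dominated_convergence)
    show "integrable M (\<lambda>x. (f x - truncation f 1 x)\<^sup>2)"
      using f by (intro L_Phi_integrable_small_part) auto
    show "AE x in M. (\<lambda>n. (f x - truncation f (S n) x)\<^sup>2) \<longlonglongrightarrow> 0"
    proof (rule AE_I2)
      fix x
      show "(\<lambda>n. (f x - truncation f (S n) x)\<^sup>2) \<longlonglongrightarrow> 0"
      proof (cases "f x = 0")
        case False
        then have "eventually (\<lambda>n. S n < \<bar>f x\<bar>) sequentially"
          using S(4) by (intro order_tendstoD) auto
        then have "eventually (\<lambda>n. (f x - truncation f (S n) x)\<^sup>2 = 0) sequentially"
          by eventually_elim (simp add: truncation_eq)
        then show ?thesis
          by (rule tendsto_eventually)
      next
        case True
        then have "truncation f (S n) x = 0" for n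
          by (simp add: truncation_eq)
        then show ?thesis
          using True by simp
      qed
    qed
    show "AE x in M. norm ((f x - truncation f (S n) x)\<^sup>2) \<le> (f x - truncation f 1 x)\<^sup>2" for n
      using S(2) [of n] by (intro AE_I2) (auto simp: truncation_eq)
  qed measurable
  then show "(\<lambda>n. \<integral>x. (f x - truncation f (S n) x)\<^sup>2 \<partial>M) \<longlonglongrightarrow> 0"
    by simp
qed simp

text \<open>Dominated convergence: \<open>Suc n\<close> keeps the levels at or above 1, where
  truncation at level 1 dominates, and at each point the truncation vanishes from some level
  on.\<close>

lemma large_part_tendsto_0:
  assumes f: "f \<in> L_Phi M"
  shows "(\<lambda>n. \<integral>x. \<bar>truncation f (real (Suc n)) x\<bar> \<partial>M) \<longlonglongrightarrow> 0"
proof -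
  have [measurable]: "f \<in> borel_measurable M"
    using f by measurable
  have "(\<lambda>n. \<integral>x. \<bar>truncation f (real (Suc n)) x\<bar> \<partial>M) \<longlonglongrightarrow> (\<integral>x. 0 \<partial>M)"
  proof (rule integral_dominated_convergence)
    show "integrable M (\<lambda>x. \<bar>truncation f 1 x\<bar>)"
      using f by (intro integrable_abs L_Phi_integrable_truncation) auto
    show "AE x in M. (\<lambda>n. \<bar>truncation f (real (Suc n)) x\<bar>) \<longlonglongrightarrow> 0"
    proof (rule AE_I2)
      fix x
      obtain N :: nat where N: "\<bar>f x\<bar> \<le> real N"
        using real_arch_simple by blast
      have "eventually (\<lambda>n. \<bar>truncation f (real (Suc n)) x\<bar> = 0) sequentially"
        using eventually_ge_at_top [of N] by eventually_elim (use N in \<open>auto simp: truncation_eq\<close>)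
      then show "(\<lambda>n. \<bar>truncation f (real (Suc n)) x\<bar>) \<longlonglongrightarrow> 0"
        by (rule tendsto_eventually)
    qed
    show "AE x in M. norm \<bar>truncation f (real (Suc n)) x\<bar> \<le> \<bar>truncation f 1 x\<bar>" for n
      by (intro AE_I2) (auto simp: truncation_eq)
  qed measurable
  then show ?thesis
    by simp
qed

section \<open>Convergence in measure\<close>

lemma (in prob_space) tendsto_in_measure_unique:
  fixes X :: "'i \<Rightarrow> 'a \<Rightarrow> real"
  assumes Y: "tendsto_in_measure M X Y F" and Z: "tendsto_in_measure M X Z F"
    and F: "F \<noteq> bot" and X: "eventually (\<lambda>i. X i \<in> borel_measurable M) F"
    and [measurable]: "Y \<in> borel_measurable M" "Z \<in> borel_measurable M"
  shows "AE \<omega> in M. Y \<omega> = Z \<omega>"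
proof -
  have le: "AE \<omega> in M. \<bar>Y \<omega> - Z \<omega>\<bar> \<le> 2 * \<delta>" if \<delta>: "\<delta> > 0" for \<delta>
  proof -
    \<comment> \<open>If two limits differ by more than twice \<delta>, an approximant is farther
      than \<delta> from one of them; both events have probability tending to 0.\<close>
    let ?E = "{\<omega> \<in> space M. \<not> \<bar>Y \<omega> - Z \<omega>\<bar> \<le> 2 * \<delta>}"
    have "prob ?E \<le> 0"
    proof (rule tendsto_lowerbound [OF _ _ F])
      show "((\<lambda>i. prob {\<omega> \<in> space M. \<bar>X i \<omega> - Y \<omega>\<bar> > \<delta>} + prob {\<omega> \<in> space M. \<bar>X i \<omega> - Z \<omega>\<bar> > \<delta>}) \<longlongrightarrow> 0) F"
        using tendsto_add Y Z \<delta> unfolding tendsto_in_measure_def by fastforce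
      show "eventually (\<lambda>i. prob ?E \<le> prob {\<omega> \<in> space M. \<bar>X i \<omega> - Y \<omega>\<bar> > \<delta>}
          + prob {\<omega> \<in> space M. \<bar>X i \<omega> - Z \<omega>\<bar> > \<delta>}) F"
        using X
      proof eventually_elim
        case (elim i)
        note [measurable] = elim
        have "prob ?E \<le> prob ({\<omega> \<in> space M. \<bar>X i \<omega> - Y \<omega>\<bar> > \<delta>} \<union> {\<omega> \<in> space M. \<bar>X i \<omega> - Z \<omega>\<bar> > \<delta>})"
          by (intro finite_measure_mono) auto
        also have "\<dots> \<le> prob {\<omega> \<in> space M. \<bar>X i \<omega> - Y \<omega>\<bar> > \<delta>} + prob {\<omega> \<in> space M. \<bar>X i \<omega> - Z \<omega>\<bar> > \<delta>}"
          by (intro measure_Un_le) measurable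
        finally show ?case .
      qed
    qed
    then have "prob ?E = 0"
      using measure_nonneg [of M ?E] by linarith
    then have "?E \<in> null_sets M"
      by (auto simp: null_sets_def emeasure_eq_measure)
    then show ?thesis
      by (rule AE_I') auto
  qed
  \<comment> \<open>Countably many radii allow the exceptional null sets to be united.\<close>
  have "AE \<omega> in M. \<bar>Y \<omega> - Z \<omega>\<bar> \<le> 2 * (1 / real (Suc n))" for n
    by (rule le) simp
  then have "AE \<omega> in M. \<forall>n. \<bar>Y \<omega> - Z \<omega>\<bar> \<le> 2 * (1 / real (Suc n))"
    by (subst AE_all_countable) blast
  then show ?thesis
  proof eventually_elim
    case (elim \<omega>)
    have "\<bar>Y \<omega> - Z \<omega>\<bar> \<le> 0"
    proof (rule LIMSEQ_le_const)
      show "(\<lambda>n. 2 * (1 / real (Suc n))) \<longlonglongrightarrow> 0"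
        using tendsto_mult_right_zero [OF LIMSEQ_inverse_real_of_nat] by (simp add: inverse_eq_divide)
    qed (use elim in auto)
    then show ?case
      by simp
  qed
qed

lemma (in prob_space) tendsto_L1_imp_in_measure:
  fixes X :: "'i \<Rightarrow> 'a \<Rightarrow> real"
  assumes lim: "((\<lambda>i. expectation (\<lambda>\<omega>. \<bar>X i \<omega> - Y \<omega>\<bar>)) \<longlongrightarrow> 0) F"
    and X: "eventually (\<lambda>i. integrable M (X i)) F" and Y: "integrable M Y"
  shows "tendsto_in_measure M X Y F"
  unfolding tendsto_in_measure_def
proof (intro allI impI)
  fix \<delta> :: real assume \<delta>: "\<delta> > 0"
  show "((\<lambda>i. prob {\<omega> \<in> space M. \<bar>X i \<omega> - Y \<omega>\<bar> > \<delta>}) \<longlongrightarrow> 0) F"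
  proof (rule tendsto_sandwich [OF _ _ tendsto_const])
    show "eventually (\<lambda>i. prob {\<omega> \<in> space M. \<bar>X i \<omega> - Y \<omega>\<bar> > \<delta>} \<le> expectation (\<lambda>\<omega>. \<bar>X i \<omega> - Y \<omega>\<bar>) / \<delta>) F"
      using X
    proof eventually_elim
      case (elim i)
      have [measurable]: "X i \<in> borel_measurable M" "Y \<in> borel_measurable M"
        using elim Y by auto
      have "prob {\<omega> \<in> space M. \<bar>X i \<omega> - Y \<omega>\<bar> > \<delta>} \<le> prob {\<omega> \<in> space M. \<bar>X i \<omega> - Y \<omega>\<bar> \<ge> \<delta>}"
        by (intro finite_measure_mono) auto
      also have "\<dots> \<le> expectation (\<lambda>\<omega>. \<bar>X i \<omega> - Y \<omega>\<bar>) / \<delta>"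
        using elim Y \<delta> by (intro integral_Markov_inequality_measure [where A = "{}"]) auto
      finally show ?case .
    qed
    show "((\<lambda>i. expectation (\<lambda>\<omega>. \<bar>X i \<omega> - Y \<omega>\<bar>) / \<delta>) \<longlongrightarrow> 0) F"
      using tendsto_divide [OF lim tendsto_const, of \<delta>] \<delta> by simp
  qed auto
qed

section \<open>The Poisson-Orlicz norm\<close>

context poisson_space
begin

text \<open>The difference of two truncations vanishes or equals \<open>f\<close> up to sign, the
  latter only where |f| is at most the larger level. It is thus dominated by the small part at that
  level, and the \<open>L^2\<close> bound applies.\<close>

lemma compensated_truncation_Cauchy:
  assumes f: "f \<in> L_Phi M" and "0 < a" "0 < b"
  shows "expectation (\<lambda>\<omega>. \<bar>compensated_sum (truncation f a) \<omega> - compensated_sum (truncation f b) \<omega>\<bar>)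
    \<le> sqrt (\<integral>x. (f x - truncation f (max a b) x)\<^sup>2 \<partial>M)"
proof -
  let ?d = "\<lambda>x. truncation f a x - truncation f b x"
  have [measurable]: "f \<in> borel_measurable M"
    using f by measurable
  have int: "integrable M (truncation f a)" "integrable M (truncation f b)"
    using assms by (auto intro: L_Phi_integrable_truncation)
  have small: "integrable M (\<lambda>x. (f x - truncation f (max a b) x)\<^sup>2)"
    using assms by (intro L_Phi_integrable_small_part) auto
  have le: "(?d x)\<^sup>2 \<le> (f x - truncation f (max a b) x)\<^sup>2" for x
    by (auto simp: truncation_eq)
  have d2: "integrable M (\<lambda>x. (?d x)\<^sup>2)"
    by (rule Bochner_Integration.integrable_bound [OF small]) (auto simp: le)
  have "expectation (\<lambda>\<omega>. \<bar>compensated_sum (truncation f a) \<omega> - compensated_sum (truncation f b) \<omega>\<bar>)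
      = expectation (\<lambda>\<omega>. \<bar>compensated_sum ?d \<omega>\<bar>)"
  proof (rule integral_cong_AE)
    show "AE \<omega> in P. \<bar>compensated_sum (truncation f a) \<omega> - compensated_sum (truncation f b) \<omega>\<bar>
        = \<bar>compensated_sum ?d \<omega>\<bar>"
      using AE_compensated_sum_diff [OF int] by eventually_elim simp
  qed measurable
  also have "\<dots> \<le> sqrt (\<integral>x. (?d x)\<^sup>2 \<partial>M)"
    using int d2 by (intro compensated_sum_L2_bound) auto
  also have "\<dots> \<le> sqrt (\<integral>x. (f x - truncation f (max a b) x)\<^sup>2 \<partial>M)"
    by (intro real_sqrt_le_mono integral_mono d2 small le)
  finally show ?thesis .
qed

text \<open>Completeness of \<open>L^1\<close> in quantitative form: the limit is built along a
  subsequence of the levels 1 / (n + 1), but the error bound holds at every positive level.\<close>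

lemma compensated_truncation_limit:
  assumes f: "f \<in> L_Phi M"
  obtains Z where "integrable P Z"
    "\<And>\<epsilon>. 0 < \<epsilon> \<Longrightarrow> expectation (\<lambda>\<omega>. \<bar>compensated_sum (truncation f \<epsilon>) \<omega> - Z \<omega>\<bar>)
      \<le> sqrt (\<integral>x. (f x - truncation f \<epsilon> x)\<^sup>2 \<partial>M)"
proof -
  let ?R = "\<lambda>\<epsilon>. \<integral>x. (f x - truncation f \<epsilon> x)\<^sup>2 \<partial>M"
  have [measurable]: "f \<in> borel_measurable M"
    using f by measurable
  define \<delta> where "\<delta> n = 1 / real (Suc n)" for n
  have \<delta>: "0 < \<delta> n" for n
    by (simp add: \<delta>_def)
  have \<delta>0: "\<delta> \<longlonglongrightarrow> 0"
    unfolding \<delta>_def [abs_def] by (rule LIMSEQ_Suc [OF lim_1_over_n])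
  have \<delta>_antimono: "\<delta> m \<le> \<delta> n" if "n \<le> m" for m n
    using that by (simp add: \<delta>_def frac_le)
  have R_mono: "?R a \<le> ?R b" if "0 < a" "a \<le> b" for a b
    using that f
    by (intro integral_mono L_Phi_integrable_small_part) (auto simp: truncation_eq)
  have "filterlim \<delta> (at_right 0) sequentially"
    using \<delta>0 by (simp add: filterlim_at \<delta> \<delta> [THEN less_imp_neq, symmetric])
  then have R\<delta>: "(\<lambda>n. sqrt (?R (\<delta> n))) \<longlonglongrightarrow> 0"
    using tendsto_real_sqrt [OF filterlim_compose [OF small_part_tendsto_0 [OF f]]] by simp
  let ?s = "\<lambda>n. compensated_sum (truncation f (\<delta> n))"
  have int: "integrable P (compensated_sum (truncation f \<epsilon>))" if "0 < \<epsilon>" for \<epsilon>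
    using f that by (intro integrable_compensated_sum L_Phi_integrable_truncation)
  have Cauchy: "\<exists>N. \<forall>i\<ge>N. \<forall>j\<ge>N. expectation (\<lambda>\<omega>. norm (?s i \<omega> - ?s j \<omega>)) < e" if "e > 0" for e
  proof -
    obtain N where N: "sqrt (?R (\<delta> N)) < e"
      using order_tendstoD(2) [OF R\<delta> \<open>e > 0\<close>] by (auto simp: eventually_sequentially)
    have "expectation (\<lambda>\<omega>. norm (?s i \<omega> - ?s j \<omega>)) < e" if "i \<ge> N" "j \<ge> N" for i j
    proof -
      have "expectation (\<lambda>\<omega>. norm (?s i \<omega> - ?s j \<omega>)) \<le> sqrt (?R (max (\<delta> i) (\<delta> j)))"
        using compensated_truncation_Cauchy [OF f \<delta> \<delta>, of i j] by simp
      also have "\<dots> \<le> sqrt (?R (\<delta> N))"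
        using that \<delta> [of i] by (intro real_sqrt_le_mono R_mono) (auto simp: less_max_iff_disj \<delta>_antimono)
      finally show ?thesis
        using N by simp
    qed
    then show ?thesis
      by blast
  qed
  obtain r where r: "strict_mono r" "AE \<omega> in P. Cauchy (\<lambda>i. ?s (r i) \<omega>)"
    by (rule cauchy_L1_AE_cauchy_subseq [of P ?s, OF int [OF \<delta>] Cauchy])
  \<comment> \<open>Outside the null set of divergence this is the pointwise limit; on it
    \<open>lim\<close> has some value, and measurability holds everywhere.\<close>
  define Z where "Z \<omega> = lim (\<lambda>i. ?s (r i) \<omega>)" for \<omega>
  have [measurable]: "Z \<in> borel_measurable P"
    unfolding Z_def [abs_def] by measurable
  have lim: "AE \<omega> in P. (\<lambda>i. ?s (r i) \<omega>) \<longlonglongrightarrow> Z \<omega>"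
    using r(2) by eventually_elim (simp add: Z_def Cauchy_convergent_iff convergent_LIMSEQ_iff)
  have bound: "(\<integral>\<^sup>+\<omega>. ennreal \<bar>compensated_sum (truncation f \<epsilon>) \<omega> - Z \<omega>\<bar> \<partial>P) \<le> ennreal (sqrt (?R \<epsilon>))"
    if \<epsilon>: "0 < \<epsilon>" for \<epsilon>
  proof -
    let ?Y = "compensated_sum (truncation f \<epsilon>)"
    \<comment> \<open>Fatou's lemma carries the Cauchy estimate over to the limit.\<close>
    have "(\<integral>\<^sup>+\<omega>. ennreal \<bar>?Y \<omega> - Z \<omega>\<bar> \<partial>P)
        = (\<integral>\<^sup>+\<omega>. liminf (\<lambda>i. ennreal \<bar>?Y \<omega> - ?s (r i) \<omega>\<bar>) \<partial>P)"
      using lim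
    proof (intro nn_integral_cong_AE, eventually_elim)
      case (elim \<omega>)
      then have "(\<lambda>i. ennreal \<bar>?Y \<omega> - ?s (r i) \<omega>\<bar>) \<longlonglongrightarrow> ennreal \<bar>?Y \<omega> - Z \<omega>\<bar>"
        by (intro tendsto_intros)
      then show ?case
        by (rule lim_imp_Liminf [OF trivial_limit_sequentially, symmetric])
    qed
    also have "\<dots> \<le> liminf (\<lambda>i. \<integral>\<^sup>+\<omega>. ennreal \<bar>?Y \<omega> - ?s (r i) \<omega>\<bar> \<partial>P)"
      by (rule nn_integral_liminf) measurable
    also have "\<dots> \<le> ennreal (sqrt (?R \<epsilon>))"
    proof (rule Liminf_le)
      \<comment> \<open>From here on \<epsilon> is the larger of the two levels, so the Cauchy
        estimate gives the small part at \<epsilon> exactly.\<close>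
      have "eventually (\<lambda>i. \<delta> (r i) < \<epsilon>) sequentially"
        using LIMSEQ_subseq_LIMSEQ [OF \<delta>0 r(1)] \<epsilon> by (intro order_tendstoD) (auto simp: o_def)
      then show "eventually (\<lambda>i. (\<integral>\<^sup>+\<omega>. ennreal \<bar>?Y \<omega> - ?s (r i) \<omega>\<bar> \<partial>P) \<le> ennreal (sqrt (?R \<epsilon>))) sequentially"
      proof eventually_elim
        case (elim i)
        have "(\<integral>\<^sup>+\<omega>. ennreal \<bar>?Y \<omega> - ?s (r i) \<omega>\<bar> \<partial>P) = ennreal (expectation (\<lambda>\<omega>. \<bar>?Y \<omega> - ?s (r i) \<omega>\<bar>))"
          using int \<epsilon> \<delta> by (intro nn_integral_eq_integral) auto
        also have "\<dots> \<le> ennreal (sqrt (?R \<epsilon>))"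
          using compensated_truncation_Cauchy [OF f \<epsilon> \<delta>, of "r i"] elim
          by (intro ennreal_leI) (simp add: max_def split: if_splits)
        finally show ?case .
      qed
    qed simp
    finally show ?thesis .
  qed
  have diff: "integrable P (\<lambda>\<omega>. compensated_sum (truncation f \<epsilon>) \<omega> - Z \<omega>)" if "0 < \<epsilon>" for \<epsilon>
    using bound [OF that] by (intro integrableI_bounded) (auto intro: le_less_trans)
  show ?thesis
  proof (rule that)
    \<comment> \<open>The limit is the compensated sum at level 1 minus an integrable error.\<close>
    show "integrable P Z"
      using Bochner_Integration.integrable_diff [OF int [of 1] diff [of 1]] by simp
    show "expectation (\<lambda>\<omega>. \<bar>compensated_sum (truncation f \<epsilon>) \<omega> - Z \<omega>\<bar>) \<le> sqrt (?R \<epsilon>)" if "0 < \<epsilon>" for \<epsilon>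
      using bound [OF that] diff [OF that] by (simp add: nn_integral_eq_integral)
  qed
qed

text \<open>The gateway from the chosen \<open>I\<^sub>1\<close> to concrete sums: the
  \<open>L^1\<close> limit shows that the choice has a witness, and uniqueness of limits in measure
  makes the chosen version agree with it almost everywhere.\<close>

lemma poisson_orlicz_norm_limit:
  assumes f: "f \<in> L_Phi M"
  shows "((\<lambda>\<epsilon>. expectation (\<lambda>\<omega>. \<bar>compensated_sum (truncation f \<epsilon>) \<omega>\<bar>))
    \<longlongrightarrow> poisson_orlicz_norm M P f) (at_right 0)"
proof -
  let ?Y = "\<lambda>\<epsilon>. compensated_sum (truncation f \<epsilon>)"
  obtain Z where Z: "integrable P Z"
    and bound: "\<And>\<epsilon>. 0 < \<epsilon> \<Longrightarrow> expectation (\<lambda>\<omega>. \<bar>?Y \<epsilon> \<omega> - Z \<omega>\<bar>)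
      \<le> sqrt (\<integral>x. (f x - truncation f \<epsilon> x)\<^sup>2 \<partial>M)"
    using compensated_truncation_limit [OF f] by blast
  have [measurable]: "f \<in> borel_measurable M" "Z \<in> borel_measurable P"
    using f Z by auto
  have pos: "eventually (\<lambda>\<epsilon> :: real. 0 < \<epsilon>) (at_right 0)"
    by (simp add: eventually_at_right_less)
  have int: "integrable P (?Y \<epsilon>)" if "0 < \<epsilon>" for \<epsilon>
    using f that by (intro integrable_compensated_sum L_Phi_integrable_truncation)
  have lim: "((\<lambda>\<epsilon>. expectation (\<lambda>\<omega>. \<bar>?Y \<epsilon> \<omega> - Z \<omega>\<bar>)) \<longlongrightarrow> 0) (at_right 0)"
  proof (rule tendsto_sandwich [OF _ _ tendsto_const])
    show "((\<lambda>\<epsilon>. sqrt (\<integral>x. (f x - truncation f \<epsilon> x)\<^sup>2 \<partial>M)) \<longlongrightarrow> 0) (at_right 0)"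
      using tendsto_real_sqrt [OF small_part_tendsto_0 [OF f]] by simp
    show "eventually (\<lambda>\<epsilon>. expectation (\<lambda>\<omega>. \<bar>?Y \<epsilon> \<omega> - Z \<omega>\<bar>)
        \<le> sqrt (\<integral>x. (f x - truncation f \<epsilon> x)\<^sup>2 \<partial>M)) (at_right 0)"
      using pos by eventually_elim (rule bound)
  qed simp
  have conv: "tendsto_in_measure P ?Y Z (at_right 0)"
    using pos by (intro tendsto_L1_imp_in_measure lim Z eventually_mono [OF pos int])
  have I1: "I\<^sub>1 M P f = (SOME Y. Y \<in> borel_measurable P \<and> tendsto_in_measure P ?Y Y (at_right 0))"
    by (simp add: I\<^sub>1_def compensated_sum_def [abs_def])
  have "I\<^sub>1 M P f \<in> borel_measurable P \<and> tendsto_in_measure P ?Y (I\<^sub>1 M P f) (at_right 0)"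
    unfolding I1 by (rule someI [of _ Z]) (simp add: conv)
  then have [measurable]: "I\<^sub>1 M P f \<in> borel_measurable P"
    and conv': "tendsto_in_measure P ?Y (I\<^sub>1 M P f) (at_right 0)"
    by auto
  have "AE \<omega> in P. I\<^sub>1 M P f \<omega> = Z \<omega>"
    by (rule tendsto_in_measure_unique [OF conv' conv]) auto
  then have norm: "poisson_orlicz_norm M P f = expectation (\<lambda>\<omega>. \<bar>Z \<omega>\<bar>)"
    unfolding poisson_orlicz_norm_def by (intro integral_cong_AE) auto
  have "((\<lambda>\<epsilon>. expectation (\<lambda>\<omega>. \<bar>?Y \<epsilon> \<omega>\<bar>) - expectation (\<lambda>\<omega>. \<bar>Z \<omega>\<bar>)) \<longlongrightarrow> 0) (at_right 0)"
  proof (rule Lim_null_comparison [OF _ lim])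
    show "eventually (\<lambda>\<epsilon>. norm (expectation (\<lambda>\<omega>. \<bar>?Y \<epsilon> \<omega>\<bar>) - expectation (\<lambda>\<omega>. \<bar>Z \<omega>\<bar>))
        \<le> expectation (\<lambda>\<omega>. \<bar>?Y \<epsilon> \<omega> - Z \<omega>\<bar>)) (at_right 0)"
      using pos
    proof eventually_elim
      case (elim \<epsilon>)
      have "norm (expectation (\<lambda>\<omega>. \<bar>?Y \<epsilon> \<omega>\<bar>) - expectation (\<lambda>\<omega>. \<bar>Z \<omega>\<bar>))
          = \<bar>expectation (\<lambda>\<omega>. \<bar>?Y \<epsilon> \<omega>\<bar> - \<bar>Z \<omega>\<bar>)\<bar>"
        using int [OF elim] Z by simp
      also have "\<dots> \<le> expectation (\<lambda>\<omega>. \<bar>\<bar>?Y \<epsilon> \<omega>\<bar> - \<bar>Z \<omega>\<bar>\<bar>)"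
        by (rule integral_abs_bound)
      also have "\<dots> \<le> expectation (\<lambda>\<omega>. \<bar>?Y \<epsilon> \<omega> - Z \<omega>\<bar>)"
        using int [OF elim] Z by (intro integral_mono) auto
      finally show ?case .
    qed
  qed
  then show ?thesis
    unfolding norm by (simp add: LIM_zero_iff)
qed

text \<open>Cutting \<open>p\<close> and \<open>q\<close> on the same set \<open>\<bar>p + q\<bar> > \<epsilon>\<close> avoids the additivity of \<open>I\<^sub>1\<close>.\<close>

lemma poisson_orlicz_norm_upper_bound:
  assumes p: "integrable M p" and q [measurable]: "q \<in> borel_measurable M"
    and q2: "integrable M (\<lambda>x. (q x)\<^sup>2)"
  shows "poisson_orlicz_norm M P (\<lambda>x. p x + q x) \<le> 2 * (\<integral>x. \<bar>p x\<bar> \<partial>M) + sqrt (\<integral>x. (q x)\<^sup>2 \<partial>M)"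
proof -
  define f where "f x = p x + q x" for x
  have [measurable]: "p \<in> borel_measurable M"
    using p by simp
  have [measurable]: "f \<in> borel_measurable M"
    unfolding f_def [abs_def] by measurable
  have f: "f \<in> L_Phi M"
    unfolding f_def [abs_def] by (intro L_Phi_sumI p q q2)
  have "poisson_orlicz_norm M P f \<le> 2 * (\<integral>x. \<bar>p x\<bar> \<partial>M) + sqrt (\<integral>x. (q x)\<^sup>2 \<partial>M)"
  proof (rule tendsto_upperbound [OF poisson_orlicz_norm_limit [OF f]])
    have "eventually (\<lambda>\<epsilon> :: real. 0 < \<epsilon>) (at_right 0)"
      by (simp add: eventually_at_right_less)
    then show "eventually (\<lambda>\<epsilon>. expectation (\<lambda>\<omega>. \<bar>compensated_sum (truncation f \<epsilon>) \<omega>\<bar>)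
        \<le> 2 * (\<integral>x. \<bar>p x\<bar> \<partial>M) + sqrt (\<integral>x. (q x)\<^sup>2 \<partial>M)) (at_right 0)"
    proof eventually_elim
      case (elim \<epsilon>)
      let ?p = "\<lambda>x. if \<epsilon> < \<bar>f x\<bar> then p x else 0" and ?q = "\<lambda>x. if \<epsilon> < \<bar>f x\<bar> then q x else 0"
      have p': "integrable M ?p"
        by (rule Bochner_Integration.integrable_bound [OF p]) auto
      have q': "integrable M (\<lambda>x. (?q x)\<^sup>2)"
        by (rule Bochner_Integration.integrable_bound [OF q2]) auto
      have "expectation (\<lambda>\<omega>. \<bar>compensated_sum (truncation f \<epsilon>) \<omega>\<bar>)
          \<le> 2 * (\<integral>x. \<bar>?p x\<bar> \<partial>M) + sqrt (\<integral>x. (?q x)\<^sup>2 \<partial>M)"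
        using f elim p' q' by (intro compensated_sum_L1_L2_bound L_Phi_integrable_truncation)
          (auto simp: truncation_eq f_def)
      also have "\<dots> \<le> 2 * (\<integral>x. \<bar>p x\<bar> \<partial>M) + sqrt (\<integral>x. (q x)\<^sup>2 \<partial>M)"
        using p p' q' q2
        by (intro add_mono mult_left_mono real_sqrt_le_mono integral_mono) auto
      finally show ?case .
    qed
  qed simp
  then show ?thesis
    by (simp add: f_def [abs_def])
qed

lemma poisson_orlicz_norm_nonneg: "0 \<le> poisson_orlicz_norm M P f"
  by (simp add: poisson_orlicz_norm_def)

text \<open>What truncation at level c removes is bounded by c, and a bounded function is integrable
  over a set of finite measure.\<close>

lemma L_Phi_integrable_on_finite_set:
  assumes f: "f \<in> L_Phi M" and A: "A \<in> finite_sets M"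
  shows "integrable M (\<lambda>x. f x * indicator A x)"
    and "0 < c \<Longrightarrow> \<bar>(\<integral>x. f x * indicator A x \<partial>M) - (\<integral>x. truncation f c x * indicator A x \<partial>M)\<bar>
      \<le> c * measure M A"
proof -
  have [measurable]: "A \<in> sets M" "f \<in> borel_measurable M"
    using f A by (auto simp: finite_sets_def)
  have A': "integrable M (\<lambda>x. c * indicator A x)" for c :: real
    using A by (intro integrable_mult_right) (simp add: finite_sets_def)
  have low: "integrable M (\<lambda>x. (f x - truncation f c x) * indicator A x)" if "0 < c" for c
    by (rule Bochner_Integration.integrable_bound [OF A' [of c]])
      (use that in \<open>auto simp: truncation_eq indicator_def\<close>)
  have high: "integrable M (\<lambda>x. truncation f c x * indicator A x)" if "0 < c" for c
    using f that by (intro integrable_real_mult_indicator L_Phi_integrable_truncation) auto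
  show int: "integrable M (\<lambda>x. f x * indicator A x)"
    using Bochner_Integration.integrable_add [OF low high, of 1 1] by (simp add: algebra_simps)
  assume c: "0 < c"
  have "\<bar>(\<integral>x. f x * indicator A x \<partial>M) - (\<integral>x. truncation f c x * indicator A x \<partial>M)\<bar>
      = \<bar>\<integral>x. (f x - truncation f c x) * indicator A x \<partial>M\<bar>"
    using int high [OF c] by (simp add: left_diff_distrib)
  also have "\<dots> \<le> (\<integral>x. \<bar>(f x - truncation f c x) * indicator A x\<bar> \<partial>M)"
    by (rule integral_abs_bound)
  also have "\<dots> \<le> (\<integral>x. c * indicator A x \<partial>M)"
    using c by (intro integral_mono integrable_abs low A') (auto simp: truncation_eq indicator_def)
  also have "\<dots> = c * measure M A"
    by simp
  finally show "\<bar>(\<integral>x. f x * indicator A x \<partial>M) - (\<integral>x. truncation f c x * indicator A x \<partial>M)\<bar>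
      \<le> c * measure M A" .
qed

text \<open>The void-event estimate holds for each truncation with a constant independent of the
  level. As the level tends to 0, the left side moves by at most \<epsilon> times the measure of
  \<open>A\<close>.\<close>

lemma set_integral_le_poisson_orlicz_norm:
  assumes f: "f \<in> L_Phi M" and A: "A \<in> finite_sets M"
  shows "\<bar>\<integral>x. f x * indicator A x \<partial>M\<bar> \<le> exp (measure M A) * poisson_orlicz_norm M P f"
proof (rule tendsto_le)
  have pos: "eventually (\<lambda>\<epsilon> :: real. 0 < \<epsilon>) (at_right 0)"
    by (simp add: eventually_at_right_less)
  show "((\<lambda>\<epsilon>. exp (measure M A) * expectation (\<lambda>\<omega>. \<bar>compensated_sum (truncation f \<epsilon>) \<omega>\<bar>))
      \<longlongrightarrow> exp (measure M A) * poisson_orlicz_norm M P f) (at_right 0)"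
    by (intro tendsto_intros poisson_orlicz_norm_limit f)
  have "((\<lambda>\<epsilon>. (\<integral>x. truncation f \<epsilon> x * indicator A x \<partial>M) - (\<integral>x. f x * indicator A x \<partial>M)) \<longlongrightarrow> 0) (at_right 0)"
  proof (rule Lim_null_comparison)
    show "eventually (\<lambda>\<epsilon>. norm ((\<integral>x. truncation f \<epsilon> x * indicator A x \<partial>M) - (\<integral>x. f x * indicator A x \<partial>M))
        \<le> \<epsilon> * measure M A) (at_right 0)"
      using pos
      by eventually_elim (use L_Phi_integrable_on_finite_set(2) [OF f A] in \<open>simp add: abs_minus_commute\<close>)
    have "((\<lambda>\<epsilon>. \<epsilon> * measure M A) \<longlongrightarrow> 0 * measure M A) (at_right 0)"
      by (intro tendsto_intros)
    then show "((\<lambda>\<epsilon>. \<epsilon> * measure M A) \<longlongrightarrow> 0) (at_right 0)"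
      by simp
  qed
  then show "((\<lambda>\<epsilon>. \<bar>\<integral>x. truncation f \<epsilon> x * indicator A x \<partial>M\<bar>)
      \<longlongrightarrow> \<bar>\<integral>x. f x * indicator A x \<partial>M\<bar>) (at_right 0)"
    by (intro tendsto_rabs) (simp add: LIM_zero_iff)
  show "eventually (\<lambda>\<epsilon>. \<bar>\<integral>x. truncation f \<epsilon> x * indicator A x \<partial>M\<bar>
      \<le> exp (measure M A) * expectation (\<lambda>\<omega>. \<bar>compensated_sum (truncation f \<epsilon>) \<omega>\<bar>)) (at_right 0)"
    using pos by eventually_elim (intro set_integral_le_compensated_sum L_Phi_integrable_truncation f A)
qed simp

end

section \<open>Averages along subsequences\<close>

lemma endomorphism_funpow:
  assumes "endomorphism M T"
  shows "endomorphism M (T ^^ n)"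
proof (induction n)
  case 0
  show ?case
    by (simp add: endomorphism_def id_def)
next
  case (Suc n)
  note [measurable] = assms [unfolded endomorphism_def, THEN conjunct1]
    Suc [unfolded endomorphism_def, THEN conjunct1]
  have "emeasure M ((T ^^ Suc n) -` A \<inter> space M) = emeasure M A" if [measurable]: "A \<in> sets M" for A
  proof -
    define E where "E = T -` A \<inter> space M"
    \<comment> \<open>The outermost map is inverted first; that \<open>T ^^ n\<close> maps the space
      into itself absorbs the intersection with \<open>space M\<close> inside
      \<open>E\<close>.\<close>
    have "(T ^^ Suc n) -` A \<inter> space M = (T ^^ n) -` E \<inter> space M"
      using measurable_space [of "T ^^ n" M M] by (auto simp: E_def)
    moreover have "E \<in> sets M"
      unfolding E_def by measurable
    moreover have "emeasure M E = emeasure M A"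
      using assms that by (simp add: E_def endomorphism_def)
    ultimately show ?thesis
      using Suc by (simp add: endomorphism_def)
  qed
  moreover have "T ^^ Suc n \<in> measurable M M"
    by simp
  ultimately show ?case
    unfolding endomorphism_def by blast
qed

lemma distr_endomorphism:
  assumes "endomorphism M T"
  shows "distr M M T = M"
  using assms by (intro measure_eqI) (auto simp: endomorphism_def emeasure_distr)

lemma endomorphism_integral:
  fixes f :: "'a \<Rightarrow> real"
  assumes T: "endomorphism M T" and f: "f \<in> borel_measurable M"
  shows "(\<integral>x. f (T x) \<partial>M) = (\<integral>x. f x \<partial>M)"
    and "integrable M f \<Longrightarrow> integrable M (\<lambda>x. f (T x))"
proof -
  have "T \<in> measurable M M"
    using T by (simp add: endomorphism_def)
  then show "(\<integral>x. f (T x) \<partial>M) = (\<integral>x. f x \<partial>M)"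
    "integrable M f \<Longrightarrow> integrable M (\<lambda>x. f (T x))"
    using integral_distr [of T M M f] integrable_distr [of T M M f] f
    by (simp_all add: distr_endomorphism [OF T])
qed

lemma endomorphism_measure:
  assumes "endomorphism M T" "A \<in> sets M"
  shows "measure M (T -` A \<inter> space M) = measure M A"
  using assms by (simp add: endomorphism_def measure_def)

text \<open>Composition with \<open>T\<close> acts separately on the \<open>L^1\<close> and the
  \<open>L^2\<close> part and preserves both kinds of integrability.\<close>

lemma endomorphism_L_Phi:
  assumes T: "endomorphism M T" and f: "f \<in> L_Phi M"
  shows "(\<lambda>x. f (T x)) \<in> L_Phi M"
proof -
  have [measurable]: "T \<in> measurable M M"
    using T by (simp add: endomorphism_def)
  obtain p q where pq: "integrable M p" "q \<in> borel_measurable M" "integrable M (\<lambda>x. (q x)\<^sup>2)"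
    "f = (\<lambda>x. p x + q x)"
    using L_Phi_decomposition [OF f] by blast
  then have "integrable M (\<lambda>x. p (T x))" "integrable M (\<lambda>x. (q (T x))\<^sup>2)"
    using endomorphism_integral(2) [OF T, of p] endomorphism_integral(2) [OF T, of "\<lambda>x. (q x)\<^sup>2"] by auto
  then show ?thesis
    using pq by (simp add: L_Phi_sumI)
qed

section \<open>Two facts on real sequences\<close>

lemma not_tendsto_0_subsequence:
  fixes a :: "nat \<Rightarrow> real"
  assumes "\<not> a \<longlonglongrightarrow> 0"
  obtains \<eta> and s :: "nat \<Rightarrow> nat" where "\<eta> > 0" "strict_mono s" "\<And>k. \<bar>a (s k)\<bar> \<ge> \<eta>"
proof -
  obtain \<eta> where \<eta>: "\<eta> > 0" "\<forall>N. \<exists>n\<ge>N. \<not> norm (a n - 0) < \<eta>"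
    using assms unfolding LIMSEQ_iff by blast
  then have inf: "infinite {n. \<bar>a n\<bar> \<ge> \<eta>}"
    unfolding infinite_nat_iff_unbounded_le by (auto simp: not_less)
  show thesis
    using that [OF \<eta>(1) strict_mono_enumerate [OF inf]] enumerate_in_set [OF inf] by blast
qed

text \<open>Each of the n rows has at most 2N entries within distance N of the diagonal, so these
  contribute O(n) out of n^2 and the others at most a small constant. Decay is required from index 1
  on, as subsequences are monotone only there.\<close>

lemma off_diagonal_average_tendsto_0:
  fixes g :: "nat \<Rightarrow> nat \<Rightarrow> real"
  assumes B: "\<And>j k. g j k \<le> B" "0 \<le> B" and nonneg: "\<And>j k. 0 \<le> g j k"
    and decay: "\<And>\<eta>. \<eta> > 0 \<Longrightarrow>
      \<exists>N. \<forall>j\<ge>1. \<forall>k\<ge>1. j + N \<le> k \<or> k + N \<le> j \<longrightarrow> g j k \<le> \<eta>"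
  shows "(\<lambda>n. (\<Sum>j=1..n. \<Sum>k=1..n. g j k) / (real n)\<^sup>2) \<longlonglongrightarrow> 0"
proof (rule order_tendstoI)
  fix \<eta> :: real assume "0 < \<eta>"
  then obtain N where N: "\<And>j k. j \<ge> 1 \<Longrightarrow> k \<ge> 1 \<Longrightarrow> j + N \<le> k \<or> k + N \<le> j \<Longrightarrow> g j k \<le> \<eta> / 2"
    using decay [of "\<eta> / 2"] by auto
  have le: "(\<Sum>j=1..n. \<Sum>k=1..n. g j k) / (real n)\<^sup>2 \<le> 2 * real N * B / real n + \<eta> / 2" if "n > 0" for n
  proof -
    have "(\<Sum>k=1..n. g j k) \<le> 2 * real N * B + real n * (\<eta> / 2)" if j: "j \<in> {1..n}" for j
    proof -
      \<comment> \<open>Subtraction of naturals stops at 0, which only shortens the window; being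
        outside it still means a distance of at least N.\<close>
      let ?I = "{1..n} \<inter> {j - N..<j + N}"
      have "g j k \<le> (if k \<in> {j - N..<j + N} then B else 0) + \<eta> / 2" if "k \<in> {1..n}" for k
      proof (cases "k \<in> {j - N..<j + N}")
        case False
        then have "j + N \<le> k \<or> k + N \<le> j"
          by auto
        then show ?thesis
          using N [of j k] j that False by auto
      qed (use B \<open>0 < \<eta>\<close> in \<open>auto intro: add_increasing2\<close>)
      then have "(\<Sum>k=1..n. g j k) \<le> (\<Sum>k=1..n. (if k \<in> {j - N..<j + N} then B else 0) + \<eta> / 2)"
        by (rule sum_mono)
      also have "\<dots> = real (card ?I) * B + real n * (\<eta> / 2)"
        by (subst sum.distrib, subst sum.inter_restrict [symmetric]) auto
      also have "\<dots> \<le> 2 * real N * B + real n * (\<eta> / 2)"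
      proof -
        have "card ?I \<le> card {j - N..<j + N}"
          by (rule card_mono) auto
        also have "\<dots> \<le> 2 * N"
          by simp
        finally have "real (card ?I) \<le> 2 * real N"
          by linarith
        then show ?thesis
          using B(2) by (simp add: mult_right_mono)
      qed
      finally show ?thesis .
    qed
    then have "(\<Sum>j=1..n. \<Sum>k=1..n. g j k) \<le> (\<Sum>j=1..n. 2 * real N * B + real n * (\<eta> / 2))"
      by (rule sum_mono)
    also have "\<dots> = (2 * real N * B / real n + \<eta> / 2) * (real n)\<^sup>2"
      using \<open>n > 0\<close> by (simp add: power2_eq_square field_simps)
    finally show ?thesis
      using \<open>n > 0\<close> by (simp add: divide_le_eq)
  qed
  have "(\<lambda>n. 2 * real N * B / real n) \<longlonglongrightarrow> 0"
    by (rule lim_const_over_n)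
  then have "eventually (\<lambda>n. 2 * real N * B / real n < \<eta> / 2) sequentially"
    using \<open>0 < \<eta>\<close> by (intro order_tendstoD) auto
  then show "eventually (\<lambda>n. (\<Sum>j=1..n. \<Sum>k=1..n. g j k) / (real n)\<^sup>2 < \<eta>) sequentially"
    using eventually_gt_at_top [of 0]
  proof eventually_elim
    case (elim n)
    then show ?case
      using le [of n] by linarith
  qed
next
  fix \<eta> :: real assume "\<eta> < 0"
  have "0 \<le> (\<Sum>j=1..n. \<Sum>k=1..n. g j k) / (real n)\<^sup>2" for n
    by (intro divide_nonneg_nonneg sum_nonneg nonneg) auto
  then show "eventually (\<lambda>n. \<eta> < (\<Sum>j=1..n. \<Sum>k=1..n. g j k) / (real n)\<^sup>2) sequentially"
    using \<open>\<eta> < 0\<close> by (intro always_eventually allI) (rule less_le_trans)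
qed

text \<open>The function whose norm occurs in \<open>subsequence_averages_vanish\<close>. For n = 0
  it is 0, because division by 0 yields 0.\<close>

definition subsequence_average :: "('a \<Rightarrow> 'a) \<Rightarrow> (nat \<Rightarrow> nat) \<Rightarrow> nat \<Rightarrow> ('a \<Rightarrow> real) \<Rightarrow> 'a \<Rightarrow> real" where
  "subsequence_average T s n f x = 1 / real n * (\<Sum>k=1..n. f ((T ^^ s k) x))"

context
  fixes M :: "'a measure" and T :: "'a \<Rightarrow> 'a"
  assumes T: "endomorphism M T"
begin

lemma measurable_funpow_endomorphism [measurable (raw)]: "T ^^ n \<in> measurable M M"
  using endomorphism_funpow [OF T] by (simp add: endomorphism_def)

lemma measurable_subsequence_average [measurable (raw)]:
  assumes [measurable]: "f \<in> borel_measurable M"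
  shows "subsequence_average T s n f \<in> borel_measurable M"
proof -
  have [measurable]: "(\<lambda>x. f ((T ^^ s k) x)) \<in> borel_measurable M" for k
    by (rule measurable_compose [OF measurable_funpow_endomorphism]) simp
  show ?thesis
    unfolding subsequence_average_def [abs_def] by measurable
qed

lemma subsequence_average_L1:
  assumes p: "integrable M p"
  shows "integrable M (subsequence_average T s n p)"
    and "(\<integral>x. \<bar>subsequence_average T s n p x\<bar> \<partial>M) \<le> (\<integral>x. \<bar>p x\<bar> \<partial>M)"
proof -
  have [measurable]: "p \<in> borel_measurable M"
    using p by simp
  have int: "integrable M (\<lambda>x. p ((T ^^ m) x))" for m
    using endomorphism_integral(2) [OF endomorphism_funpow [OF T]] p by simp
  have eq: "(\<integral>x. \<bar>p ((T ^^ m) x)\<bar> \<partial>M) = (\<integral>x. \<bar>p x\<bar> \<partial>M)" for m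
    using endomorphism_integral(1) [OF endomorphism_funpow [OF T], of "\<lambda>x. \<bar>p x\<bar>"] by simp
  show 1: "integrable M (subsequence_average T s n p)"
    unfolding subsequence_average_def [abs_def] using int by simp
  have "(\<integral>x. \<bar>subsequence_average T s n p x\<bar> \<partial>M)
      \<le> (\<integral>x. 1 / real n * (\<Sum>k=1..n. \<bar>p ((T ^^ s k) x)\<bar>) \<partial>M)"
    using int 1 by (intro integral_mono)
      (auto simp: subsequence_average_def abs_mult divide_right_mono)
  also have "\<dots> = 1 / real n * (\<Sum>k=1..n. \<integral>x. \<bar>p x\<bar> \<partial>M)"
    using int by (simp add: eq)
  \<comment> \<open>An equality except at n = 0, where the left side is 0.\<close>
  also have "\<dots> \<le> (\<integral>x. \<bar>p x\<bar> \<partial>M)"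
    by simp
  finally show "(\<integral>x. \<bar>subsequence_average T s n p x\<bar> \<partial>M) \<le> (\<integral>x. \<bar>p x\<bar> \<partial>M)" .
qed

text \<open>By Cauchy-Schwarz the square of an average is at most the average of the squares, so the
  \<open>L^1\<close> contraction applies to the square of \<open>q\<close>.\<close>

lemma subsequence_average_L2:
  assumes [measurable]: "q \<in> borel_measurable M" and q: "integrable M (\<lambda>x. (q x)\<^sup>2)"
  shows "integrable M (\<lambda>x. (subsequence_average T s n q x)\<^sup>2)"
    and "(\<integral>x. (subsequence_average T s n q x)\<^sup>2 \<partial>M) \<le> (\<integral>x. (q x)\<^sup>2 \<partial>M)"
proof -
  have int: "integrable M (subsequence_average T s n (\<lambda>x. (q x)\<^sup>2))"
    by (rule subsequence_average_L1 [OF q])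
  have le: "(subsequence_average T s n q x)\<^sup>2 \<le> subsequence_average T s n (\<lambda>x. (q x)\<^sup>2) x" for x
  proof -
    have "(\<Sum>k=1..n. q ((T ^^ s k) x))\<^sup>2 \<le> (\<Sum>k=1..n. (q ((T ^^ s k) x))\<^sup>2) * real n"
      using sum_squared_le_sum_of_squares [of "\<lambda>k. q ((T ^^ s k) x)" "{1..n}"] by simp
    then show ?thesis
      by (cases "n = 0")
        (auto simp: subsequence_average_def power_mult_distrib power2_eq_square field_simps)
  qed
  show 1: "integrable M (\<lambda>x. (subsequence_average T s n q x)\<^sup>2)"
    by (rule Bochner_Integration.integrable_bound [OF int]) (auto intro!: AE_I2 order_trans [OF le])
  have "(\<integral>x. (subsequence_average T s n q x)\<^sup>2 \<partial>M)
      \<le> (\<integral>x. \<bar>subsequence_average T s n (\<lambda>x. (q x)\<^sup>2) x\<bar> \<partial>M)"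
    using int by (intro integral_mono 1) (auto intro: order_trans [OF le])
  also have "\<dots> \<le> (\<integral>x. (q x)\<^sup>2 \<partial>M)"
    using subsequence_average_L1(2) [OF q] by simp
  finally show "(\<integral>x. (subsequence_average T s n q x)\<^sup>2 \<partial>M) \<le> (\<integral>x. (q x)\<^sup>2 \<partial>M)" .
qed

lemma subsequence_average_L_Phi:
  assumes "f \<in> L_Phi M"
  shows "subsequence_average T s n f \<in> L_Phi M"
proof -
  have "(\<lambda>x. \<Sum>k\<in>K. f ((T ^^ s k) x)) \<in> L_Phi M" if "finite K" for K
    using that
  proof (induction K)
    case empty
    show ?case
      by (simp add: integrable_in_L_Phi)
  next
    case (insert k K)
    then show ?case
      using endomorphism_L_Phi [OF endomorphism_funpow [OF T] assms] by (simp add: L_Phi_add)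
  qed
  then show ?thesis
    unfolding subsequence_average_def [abs_def] by (intro L_Phi_cmult) auto
qed

text \<open>The intersection is the preimage under \<open>T ^^ i\<close> of \<open>A\<close> met
  with its preimage under \<open>T ^^ (j - i)\<close>, and iterates preserve measure.\<close>

lemma measure_preimages_Int:
  assumes A [measurable]: "A \<in> sets M" and "i \<le> j"
  shows "measure M (((T ^^ i) -` A \<inter> space M) \<inter> ((T ^^ j) -` A \<inter> space M))
    = measure M (A \<inter> ((T ^^ (j - i)) -` A \<inter> space M))"
proof -
  define E where "E = A \<inter> ((T ^^ (j - i)) -` A \<inter> space M)"
  have "T ^^ j = (T ^^ (j - i)) \<circ> (T ^^ i)"
    using \<open>i \<le> j\<close> by (simp flip: funpow_add)
  then have "((T ^^ i) -` A \<inter> space M) \<inter> ((T ^^ j) -` A \<inter> space M) = (T ^^ i) -` E \<inter> space M"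
    using measurable_space [OF measurable_funpow_endomorphism] by (auto simp: E_def)
  moreover have "E \<in> sets M"
    unfolding E_def by (intro sets.Int A measurable_sets [OF measurable_funpow_endomorphism])
  ultimately show ?thesis
    by (simp add: endomorphism_measure [OF endomorphism_funpow [OF T]] flip: E_def)
qed

text \<open>Expanding the square turns the integral into the normalized double sum of the
  correlations of the preimages of \<open>A\<close>, which depend on the time difference
  only.\<close>

lemma zero_type_average_indicator:
  assumes zero: "zero_type M T" and A: "A \<in> finite_sets M" and s: "strict_mono_on {1..} s"
  shows "(\<lambda>n. \<integral>x. (subsequence_average T s n (indicator A) x)\<^sup>2 \<partial>M) \<longlonglongrightarrow> 0"
proof -
  have [measurable]: "A \<in> sets M"
    using A by (simp add: finite_sets_def)
  define D where "D m = (T ^^ m) -` A \<inter> space M" for m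
  have D [measurable]: "D m \<in> sets M" for m
    unfolding D_def by (rule measurable_sets [OF measurable_funpow_endomorphism]) simp
  have emD: "emeasure M (D m) = emeasure M A" for m
    using endomorphism_funpow [OF T, of m] by (simp add: endomorphism_def D_def)
  have finD: "emeasure M (D i \<inter> D j) < \<infinity>" for i j
    using emeasure_mono [of "D i \<inter> D j" "D i" M] A by (auto simp: emD finite_sets_def intro: le_less_trans)
  let ?g = "\<lambda>j k. measure M (D (s j) \<inter> D (s k))"
  have "(\<lambda>n. (\<Sum>j=1..n. \<Sum>k=1..n. ?g j k) / (real n)\<^sup>2) \<longlonglongrightarrow> 0"
  proof (rule off_diagonal_average_tendsto_0)
    show "?g j k \<le> measure M A" for j k
    proof -
      have "?g j k \<le> measure M (D (s j))"
        using finD [of "s j" "s j"] by (intro measure_mono_fmeasurable) (auto simp: fmeasurable_def)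
      then show ?thesis
        by (simp add: D_def endomorphism_measure [OF endomorphism_funpow [OF T]])
    qed
    fix \<eta> :: real assume "\<eta> > 0"
    then have "eventually (\<lambda>n. measure M (A \<inter> ((T ^^ n) -` A \<inter> space M)) < \<eta>) sequentially"
      using zero A by (intro order_tendstoD) (auto simp: zero_type_def)
    then obtain N where N: "\<And>n. n \<ge> N \<Longrightarrow> measure M (A \<inter> ((T ^^ n) -` A \<inter> space M)) < \<eta>"
      by (auto simp: eventually_sequentially)
    \<comment> \<open>A strictly increasing sequence of naturals grows by at least 1 per step, so
      indices far apart are times at least as far apart.\<close>
    have gap: "s j + m \<le> s (j + m)" if "1 \<le> j" for j m
    proof (induction m)
      case (Suc m)
      have "s (j + m) < s (j + Suc m)"
        using that by (intro strict_mono_onD [OF s]) auto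
      then show ?case
        using Suc by simp
    qed simp
    have small: "?g j k \<le> \<eta>" if "1 \<le> j" "j + N \<le> k" for j k
    proof -
      have "s j + (k - j) \<le> s k"
        using gap [OF that(1), of "k - j"] that by simp
      then have "N \<le> s k - s j" "s j \<le> s k"
        using that by auto
      then show ?thesis
        using N [of "s k - s j"] measure_preimages_Int [of A "s j" "s k"] by (simp add: D_def)
    qed
    have "\<forall>j\<ge>1. \<forall>k\<ge>1. j + N \<le> k \<or> k + N \<le> j \<longrightarrow> ?g j k \<le> \<eta>"
      using small by (metis Int_commute)
    then show "\<exists>N. \<forall>j\<ge>1. \<forall>k\<ge>1. j + N \<le> k \<or> k + N \<le> j \<longrightarrow> ?g j k \<le> \<eta>" ..
  qed auto
  moreover have "(\<integral>x. (subsequence_average T s n (indicator A) x)\<^sup>2 \<partial>M)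
      = (\<Sum>j=1..n. \<Sum>k=1..n. ?g j k) / (real n)\<^sup>2" for n
  proof -
    have "(\<integral>x. (subsequence_average T s n (indicator A) x)\<^sup>2 \<partial>M)
        = (\<integral>x. (\<Sum>j=1..n. \<Sum>k=1..n. indicator (D (s j) \<inter> D (s k)) x) / (real n)\<^sup>2 \<partial>M)"
    proof (intro Bochner_Integration.integral_cong refl)
      fix x assume "x \<in> space M"
      then have "indicat_real A ((T ^^ m) x) = indicator (D m) x" for m
        by (simp add: D_def indicator_def)
      then show "(subsequence_average T s n (indicator A) x)\<^sup>2
          = (\<Sum>j=1..n. \<Sum>k=1..n. indicator (D (s j) \<inter> D (s k)) x) / (real n)\<^sup>2"
        by (simp add: subsequence_average_def power_divide power2_eq_square sum_product indicator_inter_arith)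
    qed
    also have "\<dots> = (\<Sum>j=1..n. \<Sum>k=1..n. ?g j k) / (real n)\<^sup>2"
      using finD by simp
    finally show ?thesis .
  qed
  ultimately show ?thesis
    by simp
qed

end

section \<open>The three equivalent properties\<close>

context poisson_space
begin

text \<open>\<open>f\<close> is cut by size into a large part \<open>p\<close>, a small part
  \<open>q\<close> and a middle part \<open>h\<close>. Averaging does not enlarge the contributions
  of \<open>p\<close> and \<open>q\<close>; zero type is applied to \<open>h\<close> alone.\<close>

lemma zero_type_imp_averages_tendsto_0:
  assumes T: "endomorphism M T" and zero: "zero_type M T" and s: "strict_mono_on {1..} s"
    and f: "f \<in> L_Phi M"
  shows "(\<lambda>n. poisson_orlicz_norm M P (subsequence_average T s n f)) \<longlonglongrightarrow> 0"
proof (rule order_tendstoI)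
  fix \<eta> :: real assume \<eta>: "0 < \<eta>"
  have [measurable]: "f \<in> borel_measurable M"
    using f by measurable
  \<comment> \<open>The factor 2 under the root anticipates \<open>integrable_square_add\<close>,
    which separates \<open>q\<close> from \<open>h\<close>.\<close>
  have "((\<lambda>\<epsilon>. sqrt (2 * (\<integral>x. (f x - truncation f \<epsilon> x)\<^sup>2 \<partial>M))) \<longlongrightarrow> sqrt (2 * 0)) (at_right 0)"
    by (intro tendsto_intros small_part_tendsto_0 f)
  then have "eventually (\<lambda>\<epsilon>. sqrt (2 * (\<integral>x. (f x - truncation f \<epsilon> x)\<^sup>2 \<partial>M)) < \<eta> / 2) (at_right 0)"
    using \<eta> by (intro order_tendstoD) auto
  then obtain b where b: "b > 0"
    "\<And>\<epsilon>. 0 < \<epsilon> \<Longrightarrow> \<epsilon> < b \<Longrightarrow> sqrt (2 * (\<integral>x. (f x - truncation f \<epsilon> x)\<^sup>2 \<partial>M)) < \<eta> / 2"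
    unfolding eventually_at_right_field by blast
  \<comment> \<open>The lower level stays below 1 and hence below \<open>C\<close>, so that
    \<open>h\<close> is \<open>f\<close> restricted to \<epsilon> < |f| <= C.\<close>
  define \<epsilon> where "\<epsilon> = min 1 b / 2"
  have \<epsilon>: "0 < \<epsilon>" "\<epsilon> < 1" "\<epsilon> < b"
    using b(1) by (auto simp: \<epsilon>_def min_def)
  \<comment> \<open>A quarter, because the \<open>L^1\<close> norm enters the upper bound with the
    factor 2.\<close>
  have "eventually (\<lambda>n. (\<integral>x. \<bar>truncation f (real (Suc n)) x\<bar> \<partial>M) < \<eta> / 4) sequentially"
    using \<eta> by (intro order_tendstoD(2) [OF large_part_tendsto_0 [OF f]]) auto
  then obtain m where m: "(\<integral>x. \<bar>truncation f (real (Suc m)) x\<bar> \<partial>M) < \<eta> / 4"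
    by (auto simp: eventually_sequentially)
  define C where "C = real (Suc m)"
  have C: "1 \<le> C"
    by (simp add: C_def)
  define p where "p = truncation f C"
  define q where "q x = f x - truncation f \<epsilon> x" for x
  define h where "h x = truncation f \<epsilon> x - truncation f C x" for x
  define A where "A = {x \<in> space M. \<epsilon> < \<bar>f x\<bar>}"
  have [measurable]: "p \<in> borel_measurable M" "q \<in> borel_measurable M" "h \<in> borel_measurable M"
    "A \<in> sets M"
    unfolding p_def q_def [abs_def] h_def [abs_def] A_def by measurable
  have p: "integrable M p"
    unfolding p_def using f C by (intro L_Phi_integrable_truncation) auto
  have q2: "integrable M (\<lambda>x. (q x)\<^sup>2)"
    unfolding q_def using f \<epsilon> by (intro L_Phi_integrable_small_part) auto
  \<comment> \<open>Markov's inequality for the integrable truncation at level \<epsilon> makes the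
    measure of \<open>A\<close> finite.\<close>
  have "emeasure M A \<le> emeasure M {x \<in> space M. \<bar>truncation f \<epsilon> x\<bar> \<ge> \<epsilon>}"
    by (intro emeasure_mono) (auto simp: A_def truncation_eq)
  also have "\<dots> \<le> ennreal (1 / \<epsilon> * (\<integral>x. \<bar>truncation f \<epsilon> x\<bar> \<partial>M))"
    using f \<epsilon> by (intro integral_Markov_inequality integrable_abs L_Phi_integrable_truncation) auto
  finally have A: "A \<in> finite_sets M"
    by (auto simp: finite_sets_def intro: le_less_trans)
  have h_le: "\<bar>h x\<bar> \<le> C * indicator A x" if "x \<in> space M" for x
    using that \<epsilon> C by (auto simp: h_def A_def truncation_eq indicator_def)
  have A1: "integrable M (indicator A :: 'a \<Rightarrow> real)"
    using A by (simp add: finite_sets_def)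
  have A2: "integrable M (\<lambda>x. (indicat_real A x)\<^sup>2)"
    by (rule Bochner_Integration.integrable_bound [OF A1]) (auto simp: indicator_def)
  let ?avg = "subsequence_average T s"
  \<comment> \<open>The signs of \<open>h\<close> are given up: its average is dominated pointwise
    by \<open>C\<close> times the average of the indicator of \<open>A\<close>.\<close>
  have h_avg: "(?avg n h x)\<^sup>2 \<le> C\<^sup>2 * (?avg n (indicator A) x)\<^sup>2" if x: "x \<in> space M" for n x
  proof -
    have "\<bar>\<Sum>k=1..n. h ((T ^^ s k) x)\<bar> \<le> (\<Sum>k=1..n. C * indicator A ((T ^^ s k) x))"
      using measurable_space [OF measurable_funpow_endomorphism [OF T]] x h_le
      by (intro order_trans [OF sum_abs] sum_mono) blast
    then have "\<bar>?avg n h x\<bar> \<le> C * ?avg n (indicator A) x"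
      by (simp add: subsequence_average_def abs_mult sum_distrib_left [symmetric] divide_right_mono)
    then have "\<bar>?avg n h x\<bar>\<^sup>2 \<le> (C * ?avg n (indicator A) x)\<^sup>2"
      by (intro power_mono) auto
    then show ?thesis
      by (simp add: power_mult_distrib)
  qed
  have avgA: "integrable M (\<lambda>x. C\<^sup>2 * (?avg n (indicator A) x)\<^sup>2)" for n
    using A2 by (intro integrable_mult_right subsequence_average_L2 [OF T]) auto
  have avgh: "integrable M (\<lambda>x. (?avg n h x)\<^sup>2)" for n
    by (rule Bochner_Integration.integrable_bound [OF avgA])
      (auto intro!: AE_I2 h_avg measurable_subsequence_average [OF T] borel_measurable_power)
  have avgh_le: "(\<integral>x. (?avg n h x)\<^sup>2 \<partial>M) \<le> C\<^sup>2 * (\<integral>x. (?avg n (indicator A) x)\<^sup>2 \<partial>M)" for n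
  proof -
    have "(\<integral>x. (?avg n h x)\<^sup>2 \<partial>M) \<le> (\<integral>x. C\<^sup>2 * (?avg n (indicator A) x)\<^sup>2 \<partial>M)"
      by (intro integral_mono avgh avgA h_avg)
    then show ?thesis
      by simp
  qed
  have le: "poisson_orlicz_norm M P (?avg n f) \<le>
      2 * (\<integral>x. \<bar>p x\<bar> \<partial>M) + sqrt (2 * (\<integral>x. (q x)\<^sup>2 \<partial>M)
        + 2 * (C\<^sup>2 * (\<integral>x. (?avg n (indicator A) x)\<^sup>2 \<partial>M)))" for n
  proof -
    have "f x = p x + (q x + h x)" for x
      by (simp add: p_def q_def h_def)
    then have eq: "?avg n f = (\<lambda>x. ?avg n p x + (?avg n q x + ?avg n h x))"
      by (auto simp: subsequence_average_def sum.distrib distrib_left add_divide_distrib)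
    note meas = measurable_subsequence_average [OF T \<open>q \<in> borel_measurable M\<close>]
      measurable_subsequence_average [OF T \<open>h \<in> borel_measurable M\<close>]
    note avgq = subsequence_average_L2 [OF T \<open>q \<in> borel_measurable M\<close> q2]
    note avgp = subsequence_average_L1 [OF T p]
    have "poisson_orlicz_norm M P (?avg n f)
        \<le> 2 * (\<integral>x. \<bar>?avg n p x\<bar> \<partial>M) + sqrt (\<integral>x. (?avg n q x + ?avg n h x)\<^sup>2 \<partial>M)"
      unfolding eq
      by (intro poisson_orlicz_norm_upper_bound integrable_square_add borel_measurable_add
          avgp(1) meas avgq(1) avgh)
    also have "\<dots> \<le> 2 * (\<integral>x. \<bar>p x\<bar> \<partial>M) + sqrt (2 * (\<integral>x. (q x)\<^sup>2 \<partial>M)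
        + 2 * (C\<^sup>2 * (\<integral>x. (?avg n (indicator A) x)\<^sup>2 \<partial>M)))"
    proof (intro add_mono mult_left_mono real_sqrt_le_mono avgp(2))
      have "(\<integral>x. (?avg n q x + ?avg n h x)\<^sup>2 \<partial>M)
          \<le> 2 * (\<integral>x. (?avg n q x)\<^sup>2 \<partial>M) + 2 * (\<integral>x. (?avg n h x)\<^sup>2 \<partial>M)"
        by (intro integrable_square_add(2) meas avgq(1) avgh)
      also have "\<dots> \<le> 2 * (\<integral>x. (q x)\<^sup>2 \<partial>M) + 2 * (C\<^sup>2 * (\<integral>x. (?avg n (indicator A) x)\<^sup>2 \<partial>M))"
        by (intro add_mono mult_left_mono avgq(2) avgh_le) auto
      finally show "(\<integral>x. (?avg n q x + ?avg n h x)\<^sup>2 \<partial>M)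
          \<le> 2 * (\<integral>x. (q x)\<^sup>2 \<partial>M) + 2 * (C\<^sup>2 * (\<integral>x. (?avg n (indicator A) x)\<^sup>2 \<partial>M))" .
    qed simp
    finally show ?thesis .
  qed
  have "(\<lambda>n. 2 * (\<integral>x. \<bar>p x\<bar> \<partial>M) + sqrt (2 * (\<integral>x. (q x)\<^sup>2 \<partial>M)
        + 2 * (C\<^sup>2 * (\<integral>x. (?avg n (indicator A) x)\<^sup>2 \<partial>M))))
      \<longlonglongrightarrow> 2 * (\<integral>x. \<bar>p x\<bar> \<partial>M) + sqrt (2 * (\<integral>x. (q x)\<^sup>2 \<partial>M) + 2 * (C\<^sup>2 * 0))"
    by (intro tendsto_intros zero_type_average_indicator [OF T zero A s])
  \<comment> \<open>Both halves of the budget were chosen strictly, so the limit of the upper bounds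
    lies strictly below \<eta>.\<close>
  moreover have "2 * (\<integral>x. \<bar>p x\<bar> \<partial>M) + sqrt (2 * (\<integral>x. (q x)\<^sup>2 \<partial>M) + 2 * (C\<^sup>2 * 0)) < \<eta>"
    using m b(2) [OF \<epsilon>(1,3)] by (simp add: p_def q_def C_def)
  ultimately have "eventually (\<lambda>n. 2 * (\<integral>x. \<bar>p x\<bar> \<partial>M) + sqrt (2 * (\<integral>x. (q x)\<^sup>2 \<partial>M)
        + 2 * (C\<^sup>2 * (\<integral>x. (?avg n (indicator A) x)\<^sup>2 \<partial>M))) < \<eta>) sequentially"
    by (rule order_tendstoD)
  then show "eventually (\<lambda>n. poisson_orlicz_norm M P (?avg n f) < \<eta>) sequentially"
    by eventually_elim (rule le_less_trans [OF le])
qed (intro always_eventually allI less_le_trans [OF _ poisson_orlicz_norm_nonneg])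

lemma averages_tendsto_0_imp_weakly:
  assumes T: "endomorphism M T" and f: "f \<in> L_Phi M"
    and avg: "\<And>s. strict_mono_on {1..} s \<Longrightarrow>
      (\<lambda>n. poisson_orlicz_norm M P (subsequence_average T s n f)) \<longlonglongrightarrow> 0"
  shows "tendsto_weakly M P (\<lambda>n. f \<circ> (T ^^ n)) (\<lambda>_. 0)"
  unfolding tendsto_weakly_def
proof (intro allI impI)
  fix l assume l: "continuous_functional M P l"
  then have l_add: "l (\<lambda>x. g x + h x) = l g + l h" if "g \<in> L_Phi M" "h \<in> L_Phi M" for g h
    using that by (simp add: continuous_functional_def)
  have l_cmult: "l (\<lambda>x. c * g x) = c * l g" if "g \<in> L_Phi M" for c g
    using l that by (simp add: continuous_functional_def)
  obtain K where K: "\<And>g. g \<in> L_Phi M \<Longrightarrow> \<bar>l g\<bar> \<le> K * poisson_orlicz_norm M P g"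
    using l unfolding continuous_functional_def by blast
  have l0: "l (\<lambda>_. 0) = 0"
    using l_cmult [of "\<lambda>_. 0" 0] by (simp add: integrable_in_L_Phi)
  have fT: "(\<lambda>x. f ((T ^^ m) x)) \<in> L_Phi M" for m
    by (rule endomorphism_L_Phi [OF endomorphism_funpow [OF T] f])
  \<comment> \<open>Linearity turns the functional of an average into the average of its values
    along the orbit.\<close>
  have l_avg: "l (subsequence_average T s n f) = 1 / real n * (\<Sum>k=1..n. l (f \<circ> (T ^^ s k)))" for s n
  proof -
    have "(\<lambda>x. \<Sum>k\<in>I. f ((T ^^ s k) x)) \<in> L_Phi M \<and>
        l (\<lambda>x. \<Sum>k\<in>I. f ((T ^^ s k) x)) = (\<Sum>k\<in>I. l (f \<circ> (T ^^ s k)))" if "finite I" for I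
      using that
    proof (induction I)
      case empty
      show ?case
        by (simp add: l0 integrable_in_L_Phi)
    next
      case (insert k I)
      then show ?case
        using fT [of "s k"] by (simp add: L_Phi_add l_add comp_def)
    qed
    then show ?thesis
      unfolding subsequence_average_def [abs_def] by (subst l_cmult) auto
  qed
  have "(\<lambda>n. l (f \<circ> (T ^^ n))) \<longlonglongrightarrow> 0"
  proof (rule ccontr)
    assume "\<not> ?thesis"
    then obtain \<eta> and s :: "nat \<Rightarrow> nat" where s: "\<eta> > 0" "strict_mono s"
      "\<And>k. \<bar>l (f \<circ> (T ^^ s k))\<bar> \<ge> \<eta>"
      by (rule not_tendsto_0_subsequence) blast
    \<comment> \<open>Values of opposite sign could cancel in an average, so an infinite index set
      with a single sign \<sigma> is extracted.\<close>
    define pos where "pos = {k. l (f \<circ> (T ^^ s k)) \<ge> \<eta>}"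
    define neg where "neg = {k. - l (f \<circ> (T ^^ s k)) \<ge> \<eta>}"
    have "k \<in> pos \<union> neg" for k
      using s(3) [of k] by (auto simp: pos_def neg_def)
    then have "pos \<union> neg = UNIV"
      by blast
    then have "infinite pos \<or> infinite neg"
      by (metis finite_Un infinite_UNIV_nat)
    then obtain I \<sigma> where I: "infinite I" and \<sigma>: "\<bar>\<sigma>\<bar> = 1"
      "\<And>k. k \<in> I \<Longrightarrow> \<sigma> * l (f \<circ> (T ^^ s k)) \<ge> \<eta>"
    proof
      assume "infinite pos"
      then show thesis
        by (rule that [of _ 1]) (auto simp: pos_def)
    next
      assume "infinite neg"
      then show thesis
        by (rule that [of _ "- 1"]) (auto simp: neg_def)
    qed
    define t where "t = s \<circ> enumerate I"
    have "strict_mono t"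
      unfolding t_def using s(2) strict_mono_enumerate [OF I] by (rule strict_mono_o)
    then have t: "strict_mono_on {1..} t"
      by (auto simp: strict_mono_on_def strict_mono_def)
    \<comment> \<open>With constant sign each signed value is at least \<eta>, hence so is their
      average; continuity of \<open>l\<close> bounds it by the norm. Only n = 0 is excluded, where
      the average is empty.\<close>
    have lower: "\<eta> \<le> K * poisson_orlicz_norm M P (subsequence_average T t n f)" if "n \<ge> 1" for n
    proof -
      have "\<eta> = 1 / real n * (\<Sum>k=1..n. \<eta>)"
        using that by simp
      also have "\<dots> \<le> 1 / real n * (\<Sum>k=1..n. \<sigma> * l (f \<circ> (T ^^ t k)))"
        using \<sigma>(2) enumerate_in_set [OF I] by (intro mult_left_mono sum_mono) (auto simp: t_def)
      also have "\<dots> = \<sigma> * l (subsequence_average T t n f)"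
        by (simp add: l_avg sum_distrib_left)
      also have "\<dots> \<le> \<bar>l (subsequence_average T t n f)\<bar>"
        using \<sigma>(1) abs_ge_self [of "\<sigma> * l (subsequence_average T t n f)"] by (simp add: abs_mult)
      also have "\<dots> \<le> K * poisson_orlicz_norm M P (subsequence_average T t n f)"
        by (intro K subsequence_average_L_Phi T f)
      finally show ?thesis .
    qed
    have "(\<lambda>n. K * poisson_orlicz_norm M P (subsequence_average T t n f)) \<longlonglongrightarrow> K * 0"
      by (intro tendsto_intros avg t)
    then have "\<eta> \<le> K * 0"
      by (rule LIMSEQ_le_const) (use lower in blast)
    then show False
      using s(1) by simp
  qed
  then show "(\<lambda>n. l (f \<circ> (T ^^ n))) \<longlonglongrightarrow> l (\<lambda>_. 0)"
    by (simp add: l0)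
qed

text \<open>Supplies the test functionals: the bounding constant is the inverse void probability
  from \<open>set_integral_le_poisson_orlicz_norm\<close>.\<close>

lemma continuous_functional_set_integral:
  assumes A: "A \<in> finite_sets M"
  shows "continuous_functional M P (\<lambda>f. \<integral>x. f x * indicator A x \<partial>M)"
  unfolding continuous_functional_def
proof (intro conjI ballI allI exI)
  show "(\<integral>x. (f x + g x) * indicator A x \<partial>M)
      = (\<integral>x. f x * indicator A x \<partial>M) + (\<integral>x. g x * indicator A x \<partial>M)"
    if "f \<in> L_Phi M" "g \<in> L_Phi M" for f g
    using L_Phi_integrable_on_finite_set(1) [OF _ A] that by (simp add: distrib_right)
  show "(\<integral>x. c * f x * indicator A x \<partial>M) = c * (\<integral>x. f x * indicator A x \<partial>M)" for f and c :: real
    by (simp add: mult.assoc)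
  show "\<bar>\<integral>x. f x * indicator A x \<partial>M\<bar> \<le> exp (measure M A) * poisson_orlicz_norm M P f"
    if "f \<in> L_Phi M" for f
    using that A by (rule set_integral_le_poisson_orlicz_norm)
qed

lemma integral_indicator_funpow:
  assumes T: "endomorphism M T" and A: "A \<in> finite_sets M" and B: "B \<in> finite_sets M"
  shows "integrable M (\<lambda>x. indicator B ((T ^^ n) x) * indicat_real A x)"
    and "(\<integral>x. indicator B ((T ^^ n) x) * indicat_real A x \<partial>M) = measure M (A \<inter> ((T ^^ n) -` B \<inter> space M))"
proof -
  have [measurable]: "A \<in> sets M" "B \<in> sets M" "T ^^ n \<in> measurable M M"
    using A B endomorphism_funpow [OF T] by (auto simp: finite_sets_def endomorphism_def)
  have E: "A \<inter> ((T ^^ n) -` B \<inter> space M) \<in> sets M"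
    by measurable
  have "emeasure M (A \<inter> ((T ^^ n) -` B \<inter> space M)) \<le> emeasure M A"
    by (intro emeasure_mono) auto
  then have fin: "emeasure M (A \<inter> ((T ^^ n) -` B \<inter> space M)) < \<infinity>"
    using A by (auto simp: finite_sets_def intro: le_less_trans)
  have eq: "indicator B ((T ^^ n) x) * indicat_real A x = indicator (A \<inter> ((T ^^ n) -` B \<inter> space M)) x"
    if "x \<in> space M" for x
    using that by (auto simp: indicator_def)
  show "integrable M (\<lambda>x. indicator B ((T ^^ n) x) * indicat_real A x)"
    using E fin by (subst Bochner_Integration.integrable_cong [OF refl eq]) auto
  show "(\<integral>x. indicator B ((T ^^ n) x) * indicat_real A x \<partial>M) = measure M (A \<inter> ((T ^^ n) -` B \<inter> space M))"
    using E fin by (subst Bochner_Integration.integral_cong [OF refl eq]) auto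
qed

lemma indicator_in_L_Phi:
  assumes "A \<in> finite_sets M"
  shows "integrable M (indicat_real A)" and "indicat_real A \<in> L_Phi M"
  using assms by (auto simp: finite_sets_def intro!: integrable_in_L_Phi)

text \<open>The correlation of \<open>A\<close> and \<open>B\<close> at time n is integration over
  \<open>A\<close> applied to the indicator of \<open>B\<close> moved by
  \<open>T ^^ n\<close>.\<close>

lemma weakly_imp_zero_type:
  assumes T: "endomorphism M T"
    and weak: "\<And>f. f \<in> L_Phi M \<Longrightarrow> tendsto_weakly M P (\<lambda>n. f \<circ> (T ^^ n)) (\<lambda>_. 0)"
  shows "zero_type M T"
  unfolding zero_type_def
proof (intro ballI)
  fix A B assume A: "A \<in> finite_sets M" and B: "B \<in> finite_sets M"
  have "(\<lambda>n. \<integral>x. (indicator B \<circ> (T ^^ n)) x * indicat_real A x \<partial>M) \<longlonglongrightarrow> (\<integral>x. 0 * indicator A x \<partial>M)"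
    using weak [OF indicator_in_L_Phi(2) [OF B]] continuous_functional_set_integral [OF A]
    unfolding tendsto_weakly_def by blast
  then show "(\<lambda>n. measure M (A \<inter> ((T ^^ n) -` B \<inter> space M))) \<longlonglongrightarrow> 0"
    by (simp add: integral_indicator_funpow [OF T A B])
qed

text \<open>Correlations are nonnegative, so along a subsequence where they stay above \<eta> their
  averages do as well; these averages are integrals over \<open>A\<close>, which the norm
  controls.\<close>

lemma averages_imp_zero_type:
  assumes T: "endomorphism M T"
    and avg: "\<And>s f. strict_mono_on {1..} s \<Longrightarrow> integrable M f \<Longrightarrow>
      (\<lambda>n. poisson_orlicz_norm M P (subsequence_average T s n f)) \<longlonglongrightarrow> 0"
  shows "zero_type M T"
  unfolding zero_type_def
proof (intro ballI, rule ccontr)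
  fix A B assume A: "A \<in> finite_sets M" and B: "B \<in> finite_sets M"
  assume "\<not> (\<lambda>n. measure M (A \<inter> ((T ^^ n) -` B \<inter> space M))) \<longlonglongrightarrow> 0"
  then obtain \<eta> and s :: "nat \<Rightarrow> nat" where \<eta>: "\<eta> > 0" and s: "strict_mono s"
    and ge: "\<And>k. \<bar>measure M (A \<inter> ((T ^^ s k) -` B \<inter> space M))\<bar> \<ge> \<eta>"
    by (rule not_tendsto_0_subsequence) blast
  have s': "strict_mono_on {1..} s"
    using s by (auto simp: strict_mono_on_def strict_mono_def)
  let ?f = "\<lambda>n. subsequence_average T s n (indicator B)"
  have lower: "\<eta> \<le> exp (measure M A) * poisson_orlicz_norm M P (?f n)" if "n \<ge> 1" for n
  proof -
    have "\<eta> = 1 / real n * (\<Sum>k=1..n. \<eta>)"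
      using that by simp
    also have "\<dots> \<le> 1 / real n * (\<Sum>k=1..n. measure M (A \<inter> ((T ^^ s k) -` B \<inter> space M)))"
      using ge by (intro mult_left_mono sum_mono) auto
    also have "\<dots> = 1 / real n * (\<integral>x. (\<Sum>k=1..n. indicator B ((T ^^ s k) x) * indicat_real A x) \<partial>M)"
      by (subst Bochner_Integration.integral_sum) (simp_all only: integral_indicator_funpow [OF T A B])
    also have "\<dots> = (\<integral>x. 1 / real n * (\<Sum>k=1..n. indicator B ((T ^^ s k) x) * indicat_real A x) \<partial>M)"
      by (rule integral_mult_right_zero [symmetric])
    also have "\<dots> = (\<integral>x. ?f n x * indicator A x \<partial>M)"
      by (simp only: subsequence_average_def sum_distrib_right mult.assoc)
    also have "\<dots> \<le> \<bar>\<integral>x. ?f n x * indicator A x \<partial>M\<bar>"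
      by (rule abs_ge_self)
    also have "\<dots> \<le> exp (measure M A) * poisson_orlicz_norm M P (?f n)"
      by (intro set_integral_le_poisson_orlicz_norm subsequence_average_L_Phi T A indicator_in_L_Phi B)
    finally show ?thesis .
  qed
  have "(\<lambda>n. exp (measure M A) * poisson_orlicz_norm M P (?f n)) \<longlonglongrightarrow> exp (measure M A) * 0"
    by (intro tendsto_intros avg s' indicator_in_L_Phi B)
  then have "\<eta> \<le> exp (measure M A) * 0"
    by (rule LIMSEQ_le_const) (use lower in blast)
  then show False
    using \<eta> by simp
qed

end

text \<open>The preimages of the intervals [-n, n] cover the space and have finite measure.\<close>

lemma isomorphic_to_real_line_sigma_finite:
  assumes "isomorphic_to_real_line M"
  shows "sigma_finite_measure M"
proof -
  obtain \<phi> :: "'a \<Rightarrow> real" where \<phi> [measurable]: "\<phi> \<in> measurable M borel" and distr: "distr M borel \<phi> = lborel"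
    using assms by (auto simp: isomorphic_to_real_line_def)
  have "emeasure M (\<phi> -` {- real n..real n} \<inter> space M) = emeasure (distr M borel \<phi>) {- real n..real n}" for n
    by (simp add: emeasure_distr)
  then have fin: "emeasure M (\<phi> -` {- real n..real n} \<inter> space M) \<noteq> \<infinity>" for n
    by (simp add: distr)
  have "x \<in> (\<Union>n. \<phi> -` {- real n..real n} \<inter> space M)" if "x \<in> space M" for x
  proof -
    obtain n where "\<bar>\<phi> x\<bar> \<le> real n"
      using real_arch_simple by blast
    then show ?thesis
      using that by (auto simp: abs_le_iff intro!: exI [of _ n])
  qed
  then show ?thesis
    using fin
    by (intro sigma_finite_measure.intro exI [of _ "range (\<lambda>n. \<phi> -` {- real n..real n} \<inter> space M)"]) auto
qed

theorem theorem28: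
  fixes M :: "'a measure" and P :: "'a measure measure" and T :: "'a \<Rightarrow> 'a"
  assumes "isomorphic_to_real_line M"
    and "is_poisson_measure M P"
    and "endomorphism M T"
  shows "(zero_type M T \<longleftrightarrow>
            (\<forall>f\<in>L_Phi M. tendsto_weakly M P (\<lambda>n. f \<circ> (T ^^ n)) (\<lambda>_. 0))) \<and>
         (zero_type M T \<longleftrightarrow> subsequence_averages_vanish M P T {f. integrable M f}) \<and>
         (zero_type M T \<longleftrightarrow> subsequence_averages_vanish M P T (L_Phi M))"
proof -
  interpret poisson_space M P
    by (intro poisson_space.intro isomorphic_to_real_line_sigma_finite assms)
  have vanish: "subsequence_averages_vanish M P T F \<longleftrightarrow>
      (\<forall>s. strict_mono_on {1..} s \<longrightarrow>
        (\<forall>f\<in>F. (\<lambda>n. poisson_orlicz_norm M P (subsequence_average T s n f)) \<longlonglongrightarrow> 0))" for F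
    by (simp add: subsequence_averages_vanish_def subsequence_average_def [abs_def])
  have L_Phi: "subsequence_averages_vanish M P T (L_Phi M)" if "zero_type M T"
    using zero_type_imp_averages_tendsto_0 [OF assms(3) that] by (auto simp: vanish)
  have L1: "subsequence_averages_vanish M P T {f. integrable M f}"
    if "subsequence_averages_vanish M P T (L_Phi M)"
    using that integrable_in_L_Phi by (auto simp: vanish)
  have zero: "zero_type M T" if "subsequence_averages_vanish M P T {f. integrable M f}"
    using averages_imp_zero_type [OF assms(3)] that by (auto simp: vanish)
  have weak: "tendsto_weakly M P (\<lambda>n. f \<circ> (T ^^ n)) (\<lambda>_. 0)" if "zero_type M T" "f \<in> L_Phi M" for f
    using averages_tendsto_0_imp_weakly [OF assms(3) that(2)] L_Phi [OF that(1)] that(2)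
    by (simp add: vanish)
  \<comment> \<open>Two cycles through zero type: over averages on \<open>L_Phi\<close> and then on
    integrable functions, and over averages on \<open>L_Phi\<close> and then weak
    convergence.\<close>
  show ?thesis
    using L_Phi L1 zero weak weakly_imp_zero_type [OF assms(3)] by blast
qed

end
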